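(* Let $(\mathscr E,t)=\{t_k\}_{k\in\mathbb Z}$ be an $\mathcal A$-Hilbert complex with strong Hodge decomposition. Then, for every $k\in\mathbb Z$, there is an isomorphism of Hilbert $\mathcal A$-modules $$\mathcal H_k(\mathscr E,t)\cong\ker t_k\cap\ker t_{k-1}^* .$$
   Context: $\mathcal A$ is a fixed complex C*-algebra. Hilbert $\mathcal A$-modules are right Hilbert C*-modules over $\mathcal A$; $\oplus$ is the orthogonal direct sum. A densely defined $\mathcal A$-linear operator $t\colon \mathrm{dom}(t)\subset \mathscr E\to\mathscr F$ is semi-regular if its adjoint $t^*$ is densely defined; a semi-regular $t$ is regular if it is closed and $1+t^*t$ has dense range. $\mathcal R_{\mathcal A}(\mathscr E,\mathscr F)$ denotes the set of regular operators. An $\mathcal A$-Hilbert complex $(\mathscr E,t)$ is a sequence of regular operators $t_k\in\mathcal R_{\mathcal A}(\mathscr E_k,\mathscr E_{k+1})$, $k\in\mathbb Z$, between Hilbert $\mathcal A$-modules, with $\mathrm{ran}(t_k)\subset\ker(t_{k+1})$ for all $k$. It has strong Hodge decomposition if for all $k\in\mathbb Z$, $\mathscr E_k=(\ker t_k\cap\ker t_{k-1}^* )\oplus\mathrm{ran}(t_k^* )\oplus\mathrm{ran}(t_{k-1})$. The cohomology groups are $\mathcal H_k(\mathscr E,t)=\ker t_k/\mathrm{ran}(t_{k-1})$. When $\mathrm{ran}(t_{k-1})$ is closed and orthogonally complemented in $\ker t_k$, the quotient is a Hilbert $\mathcal A$-module with inner product $\langle x+\mathrm{ran}(t_{k-1})\mid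 y+\mathrm{ran}(t_{k-1})\rangle=\langle px\mid py\rangle$, where $p$ is the orthogonal projection of $\ker t_k$ onto the orthogonal complement of $\mathrm{ran}(t_{k-1})$ in $\ker t_k$. *)

theory Defs
  imports "HOL-Analysis.Analysis" "HOL-Algebra.AbelCoset"
begin

section \<open>Complex C*-algebras\<close>

text \<open>
  Not necessarily unital, and possibly zero.
\<close>

class cstar_algebra = real_normed_algebra + banach +
  fixes cscaleA :: "complex \<Rightarrow> 'a \<Rightarrow> 'a"
    and cstar :: "'a \<Rightarrow> 'a"
  assumes cscaleA_add_right: "cscaleA c (x + y) = cscaleA c x + cscaleA c y"
    and cscaleA_add_left: "cscaleA (c + d) x = cscaleA c x + cscaleA d x"
    and cscaleA_cscaleA: "cscaleA c (cscaleA d x) = cscaleA (c * d) x"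
    and cscaleA_of_real: "cscaleA (complex_of_real r) x = scaleR r x"
    and norm_cscaleA: "norm (cscaleA c x) = cmod c * norm x"
    and cscaleA_mult_left: "cscaleA c x * y = cscaleA c (x * y)"
    and cscaleA_mult_right: "x * cscaleA c y = cscaleA c (x * y)"
    and cstar_add: "cstar (x + y) = cstar x + cstar y"
    and cstar_cscaleA: "cstar (cscaleA c x) = cscaleA (cnj c) (cstar x)"
    and cstar_mult: "cstar (x * y) = cstar y * cstar x"
    and cstar_cstar: "cstar (cstar x) = x"
    and cstar_identity: "norm (cstar x * x) = (norm x)\<^sup>2"

definition cstar_nonneg :: "'a::cstar_algebra \<Rightarrow> bool"
  where "cstar_nonneg a \<longleftrightarrow> (\<exists>b. a = cstar b * b)"


section \<open>Hilbert C*-modules\<close>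

text \<open>
  The modules of a complex have different underlying sets, so a module is a record with an explicit
  carrier. As in \<^theory>\<open>HOL-Algebra.Ring\<close> and its extensions, an additive group is an
  \<^locale>\<open>abelian_group\<close> structure on a ring record; the multiplicative fields are
  irrelevant.
\<close>

record ('a, 'e) hmodule = "'e ring" +
  cscale :: "complex \<Rightarrow> 'e \<Rightarrow> 'e" (infixr "\<odot>\<index>" 70)
  act :: "'e \<Rightarrow> 'a \<Rightarrow> 'e" (infixl "\<rhd>\<index>" 70)
  ip :: "'e \<Rightarrow> 'e \<Rightarrow> 'a" ("\<langle>_, _\<rangle>\<index>")

definition hnorm :: "('a::cstar_algebra, 'e) hmodule \<Rightarrow> 'e \<Rightarrow> real"
  where "hnorm E x = sqrt (norm \<langle>x, x\<rangle>\<^bsub>E\<^esub>)"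

text \<open>
  The locale \<^locale>\<open>Metric_space\<close> asks for nonnegativity and symmetry also off the
  carrier, hence the value \<open>0\<close> there.
\<close>

definition hdist :: "('a::cstar_algebra, 'e) hmodule \<Rightarrow> 'e \<Rightarrow> 'e \<Rightarrow> real"
  where "hdist E x y =
    (if x \<in> carrier E \<and> y \<in> carrier E then hnorm E (x \<ominus>\<^bsub>E\<^esub> y) else 0)"

abbreviation htop :: "('a::cstar_algebra, 'e) hmodule \<Rightarrow> 'e topology"
  where "htop E \<equiv> Metric_space.mtopology (carrier E) (hdist E)"

text \<open>
  Right modules, with inner product conjugate-linear in the first and linear in the second argument.
\<close>

locale hilbert_module = abelian_group E
  for E :: "('a::cstar_algebra, 'e) hmodule" (structure) +
  assumes cscale_closed: "x \<in> carrier E \<Longrightarrow> c \<odot> x \<in> carrier E"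
    and cscale_add_right:
      "\<lbrakk>x \<in> carrier E; y \<in> carrier E\<rbrakk> \<Longrightarrow> c \<odot> (x \<oplus> y) = (c \<odot> x) \<oplus> (c \<odot> y)"
    and cscale_add_left: "x \<in> carrier E \<Longrightarrow> (c + d) \<odot> x = (c \<odot> x) \<oplus> (d \<odot> x)"
    and cscale_cscale: "x \<in> carrier E \<Longrightarrow> c \<odot> (d \<odot> x) = (c * d) \<odot> x"
    and cscale_one: "x \<in> carrier E \<Longrightarrow> 1 \<odot> x = x"
    and act_closed: "x \<in> carrier E \<Longrightarrow> x \<rhd> a \<in> carrier E"
    and act_add_left:
      "\<lbrakk>x \<in> carrier E; y \<in> carrier E\<rbrakk> \<Longrightarrow> (x \<oplus> y) \<rhd> a = (x \<rhd> a) \<oplus> (y \<rhd> a)"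
    and act_add_right: "x \<in> carrier E \<Longrightarrow> x \<rhd> (a + b) = (x \<rhd> a) \<oplus> (x \<rhd> b)"
    and act_act: "x \<in> carrier E \<Longrightarrow> (x \<rhd> a) \<rhd> b = x \<rhd> (a * b)"
    and cscale_act: "x \<in> carrier E \<Longrightarrow> (c \<odot> x) \<rhd> a = c \<odot> (x \<rhd> a)"
    and act_cscaleA: "x \<in> carrier E \<Longrightarrow> x \<rhd> cscaleA c a = c \<odot> (x \<rhd> a)"
    and ip_add_right: "\<lbrakk>x \<in> carrier E; y \<in> carrier E; z \<in> carrier E\<rbrakk>
      \<Longrightarrow> \<langle>x, y \<oplus> z\<rangle> = \<langle>x, y\<rangle> + \<langle>x, z\<rangle>"
    and ip_cscale_right:
      "\<lbrakk>x \<in> carrier E; y \<in> carrier E\<rbrakk> \<Longrightarrow> \<langle>x, c \<odot> y\<rangle> = cscaleA c \<langle>x, y\<rangle>"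
    and ip_act_right:
      "\<lbrakk>x \<in> carrier E; y \<in> carrier E\<rbrakk> \<Longrightarrow> \<langle>x, y \<rhd> a\<rangle> = \<langle>x, y\<rangle> * a"
    and ip_cstar:
      "\<lbrakk>x \<in> carrier E; y \<in> carrier E\<rbrakk> \<Longrightarrow> cstar \<langle>x, y\<rangle> = \<langle>y, x\<rangle>"
    and ip_nonneg: "x \<in> carrier E \<Longrightarrow> cstar_nonneg \<langle>x, x\<rangle>"
    and ip_definite: "\<lbrakk>x \<in> carrier E; \<langle>x, x\<rangle> = 0\<rbrakk> \<Longrightarrow> x = \<zero>"
    and complete: "Metric_space.mcomplete (carrier E) (hdist E)"

definition submodule :: "('a::cstar_algebra, 'e) hmodule \<Rightarrow> 'e set \<Rightarrow> bool"
  where "submodule E D \<longleftrightarrow> D \<subseteq> carrier E \<and> \<zero>\<^bsub>E\<^esub> \<in> D \<and>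
    (\<forall>x\<in>D. \<forall>y\<in>D. x \<oplus>\<^bsub>E\<^esub> y \<in> D) \<and>
    (\<forall>x\<in>D. \<forall>c. c \<odot>\<^bsub>E\<^esub> x \<in> D) \<and>
    (\<forall>x\<in>D. \<forall>a. x \<rhd>\<^bsub>E\<^esub> a \<in> D)"

definition linear_map_on ::
  "('a::cstar_algebra, 'e) hmodule \<Rightarrow> ('a, 'f) hmodule \<Rightarrow> 'e set \<Rightarrow> ('e \<Rightarrow> 'f) \<Rightarrow> bool"
  where "linear_map_on E F D f \<longleftrightarrow> f ` D \<subseteq> carrier F \<and>
    (\<forall>x\<in>D. \<forall>y\<in>D. f (x \<oplus>\<^bsub>E\<^esub> y) = f x \<oplus>\<^bsub>F\<^esub> f y) \<and>
    (\<forall>x\<in>D. \<forall>c. f (c \<odot>\<^bsub>E\<^esub> x) = c \<odot>\<^bsub>F\<^esub> f x) \<and>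
    (\<forall>x\<in>D. \<forall>a. f (x \<rhd>\<^bsub>E\<^esub> a) = f x \<rhd>\<^bsub>F\<^esub> a)"

definition hmodule_iso ::
  "('a::cstar_algebra, 'e) hmodule \<Rightarrow> ('a, 'f) hmodule \<Rightarrow> ('e \<Rightarrow> 'f) set"
  where "hmodule_iso E F = {U. linear_map_on E F (carrier E) U \<and>
    bij_betw U (carrier E) (carrier F) \<and>
    (\<forall>x\<in>carrier E. \<forall>y\<in>carrier E. \<langle>U x, U y\<rangle>\<^bsub>F\<^esub> = \<langle>x, y\<rangle>\<^bsub>E\<^esub>)}"

definition is_hmodule_iso ::
  "('a::cstar_algebra, 'e) hmodule \<Rightarrow> ('a, 'f) hmodule \<Rightarrow> bool" (infix "\<cong>\<^sub>H" 60)
  where "E \<cong>\<^sub>H F \<longleftrightarrow> hilbert_module E \<and> hilbert_module F \<and> hmodule_iso E F \<noteq> {}"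


section \<open>Orthogonality and quotients\<close>

definition orthogonal_sets :: "('a::cstar_algebra, 'e) hmodule \<Rightarrow> 'e set \<Rightarrow> 'e set \<Rightarrow> bool"
  where "orthogonal_sets E A B \<longleftrightarrow> (\<forall>x\<in>A. \<forall>y\<in>B. \<langle>x, y\<rangle>\<^bsub>E\<^esub> = 0)"

definition orth_compl :: "('a::cstar_algebra, 'e) hmodule \<Rightarrow> 'e set \<Rightarrow> 'e set"
  where "orth_compl E N = {x \<in> carrier E. \<forall>y\<in>N. \<langle>x, y\<rangle>\<^bsub>E\<^esub> = 0}"

definition orth_complemented :: "('a::cstar_algebra, 'e) hmodule \<Rightarrow> 'e set \<Rightarrow> bool"
  where "orth_complemented E N \<longleftrightarrow>
    submodule E N \<and> carrier E = N <+>\<^bsub>E\<^esub> orth_compl E N"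

definition orth_proj :: "('a::cstar_algebra, 'e) hmodule \<Rightarrow> 'e set \<Rightarrow> 'e \<Rightarrow> 'e"
  where "orth_proj E K x = (THE y. y \<in> K \<and> x \<ominus>\<^bsub>E\<^esub> y \<in> orth_compl E K)"

text \<open>
  The inner product is meaningful only if \<open>N\<close> is orthogonally complemented: then
  \<open>\<langle>p x, p y\<rangle>\<close> depends only on the cosets of \<open>x\<close> and \<open>y\<close>.
\<close>

definition quotient_hmodule ::
  "('a::cstar_algebra, 'e) hmodule \<Rightarrow> 'e set \<Rightarrow> ('a, 'e set) hmodule"
  where "quotient_hmodule E N = (let p = orth_proj E (orth_compl E N) in
    \<lparr>carrier = a_rcosets\<^bsub>E\<^esub> N, mult = undefined, one = undefined,
     zero = N, add = (\<lambda>X Y. X <+>\<^bsub>E\<^esub> Y),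
     cscale = (\<lambda>c X. \<Union>x\<in>X. N +>\<^bsub>E\<^esub> (c \<odot>\<^bsub>E\<^esub> x)),
     act = (\<lambda>X a. \<Union>x\<in>X. N +>\<^bsub>E\<^esub> (x \<rhd>\<^bsub>E\<^esub> a)),
     ip = (\<lambda>X Y. THE a. \<forall>x\<in>X. \<forall>y\<in>Y. a = \<langle>p x, p y\<rangle>\<^bsub>E\<^esub>)\<rparr>)"


section \<open>Regular operators\<close>

text \<open>
  An unbounded operator is a partial function; \<^const>\<open>dom\<close>, \<^const>\<open>ran\<close> and
  \<^const>\<open>map_comp\<close> then have their operator-theoretic meaning.
\<close>

definition hoperator ::
  "('a::cstar_algebra, 'e) hmodule \<Rightarrow> ('a, 'f) hmodule \<Rightarrow> ('e \<rightharpoonup> 'f) \<Rightarrow> bool"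
  where "hoperator E F t \<longleftrightarrow>
    submodule E (dom t) \<and> linear_map_on E F (dom t) (\<lambda>x. the (t x))"

definition ker :: "('a::cstar_algebra, 'f) hmodule \<Rightarrow> ('e \<rightharpoonup> 'f) \<Rightarrow> 'e set"
  where "ker F t = {x. t x = Some \<zero>\<^bsub>F\<^esub>}"

definition dense_in :: "('a::cstar_algebra, 'e) hmodule \<Rightarrow> 'e set \<Rightarrow> bool"
  where "dense_in E S \<longleftrightarrow> S \<subseteq> carrier E \<and> htop E closure_of S = carrier E"

definition adjoint_pair :: "('a::cstar_algebra, 'e) hmodule \<Rightarrow> ('a, 'f) hmodule
    \<Rightarrow> ('e \<rightharpoonup> 'f) \<Rightarrow> 'f \<Rightarrow> 'e \<Rightarrow> bool"
  where "adjoint_pair E F t y z \<longleftrightarrow> y \<in> carrier F \<and> z \<in> carrier E \<and>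
    (\<forall>x\<in>dom t. \<langle>the (t x), y\<rangle>\<^bsub>F\<^esub> = \<langle>x, z\<rangle>\<^bsub>E\<^esub>)"

text \<open>
  For densely defined \<open>t\<close> the element \<open>z\<close> is unique.
\<close>

definition adj :: "('a::cstar_algebra, 'e) hmodule \<Rightarrow> ('a, 'f) hmodule
    \<Rightarrow> ('e \<rightharpoonup> 'f) \<Rightarrow> ('f \<rightharpoonup> 'e)"
  where "adj E F t = (\<lambda>y. if \<exists>z. adjoint_pair E F t y z
    then Some (THE z. adjoint_pair E F t y z) else None)"

definition semi_regular ::
  "('a::cstar_algebra, 'e) hmodule \<Rightarrow> ('a, 'f) hmodule \<Rightarrow> ('e \<rightharpoonup> 'f) \<Rightarrow> bool"
  where "semi_regular E F t \<longleftrightarrow>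
    hoperator E F t \<and> dense_in E (dom t) \<and> dense_in F (dom (adj E F t))"

definition closed_operator ::
  "('a::cstar_algebra, 'e) hmodule \<Rightarrow> ('a, 'f) hmodule \<Rightarrow> ('e \<rightharpoonup> 'f) \<Rightarrow> bool"
  where "closed_operator E F t \<longleftrightarrow>
    closedin (prod_topology (htop E) (htop F)) {(x, y). t x = Some y}"

definition regular_ops ::
  "('a::cstar_algebra, 'e) hmodule \<Rightarrow> ('a, 'f) hmodule \<Rightarrow> ('e \<rightharpoonup> 'f) set"
  where "regular_ops E F = {t. semi_regular E F t \<and> closed_operator E F t \<and>
    dense_in E {x \<oplus>\<^bsub>E\<^esub> z | x z. (adj E F t \<circ>\<^sub>m t) x = Some z}}"


section \<open>Hilbert complexes\<close>

text \<open>
  All modules of a complex have their elements in one type. This is no restriction, since the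
  carriers are arbitrary and can be embedded in a disjoint union.
\<close>

locale hilbert_complex =
  fixes E :: "int \<Rightarrow> ('a::cstar_algebra, 'e) hmodule"
    and t :: "int \<Rightarrow> ('e \<rightharpoonup> 'e)"
  assumes module: "hilbert_module (E k)"
    and regular: "t k \<in> regular_ops (E k) (E (k + 1))"
    and ran_subset_ker: "ran (t k) \<subseteq> ker (E (k + 2)) (t (k + 1))"

definition harmonic_space ::
  "(int \<Rightarrow> ('a::cstar_algebra, 'e) hmodule) \<Rightarrow> (int \<Rightarrow> ('e \<rightharpoonup> 'e)) \<Rightarrow> int \<Rightarrow> 'e set"
  where "harmonic_space E t k =
    ker (E (k + 1)) (t k) \<inter> ker (E (k - 1)) (adj (E (k - 1)) (E k) (t (k - 1)))"

definition strong_hodge_decomposition ::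
  "(int \<Rightarrow> ('a::cstar_algebra, 'e) hmodule) \<Rightarrow> (int \<Rightarrow> ('e \<rightharpoonup> 'e)) \<Rightarrow> bool"
  where "strong_hodge_decomposition E t \<longleftrightarrow> (\<forall>k.
    let H = harmonic_space E t k;
        A = ran (adj (E k) (E (k + 1)) (t k));
        B = ran (t (k - 1))
    in carrier (E k) = H <+>\<^bsub>E k\<^esub> A <+>\<^bsub>E k\<^esub> B \<and>
      orthogonal_sets (E k) H A \<and> orthogonal_sets (E k) H B \<and> orthogonal_sets (E k) A B)"

definition kernel_module ::
  "(int \<Rightarrow> ('a::cstar_algebra, 'e) hmodule) \<Rightarrow> (int \<Rightarrow> ('e \<rightharpoonup> 'e)) \<Rightarrow> int \<Rightarrow> ('a, 'e) hmodule"
  where "kernel_module E t k = (E k)\<lparr>carrier := ker (E (k + 1)) (t k)\<rparr>"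

definition harmonic_module ::
  "(int \<Rightarrow> ('a::cstar_algebra, 'e) hmodule) \<Rightarrow> (int \<Rightarrow> ('e \<rightharpoonup> 'e)) \<Rightarrow> int \<Rightarrow> ('a, 'e) hmodule"
  where "harmonic_module E t k = (E k)\<lparr>carrier := harmonic_space E t k\<rparr>"

definition cohomology_module ::
  "(int \<Rightarrow> ('a::cstar_algebra, 'e) hmodule) \<Rightarrow> (int \<Rightarrow> ('e \<rightharpoonup> 'e)) \<Rightarrow> int
    \<Rightarrow> ('a, 'e set) hmodule"
  where "cohomology_module E t k = quotient_hmodule (kernel_module E t k) (ran (t (k - 1)))"

end

theory Submission
  imports Defs
begin

text \<open>
  Fix \<open>k\<close> and write \<open>K\<close> for the kernel of \<open>t k\<close>, \<open>H\<close> for the harmonic space, \<open>A\<close> for the range of the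
  adjoint of \<open>t k\<close> and \<open>B\<close> for the range of \<open>t (k - 1)\<close>. By the adjunction formula \<open>K\<close> is orthogonal to
  \<open>A\<close> (\<open>ker_orthogonal_ran_adj\<close>). As \<open>H\<close> and \<open>B\<close> lie in \<open>K\<close>, the orthogonal decomposition of
  \<open>E k\<close> into \<open>H\<close>, \<open>A\<close> and \<open>B\<close> forces \<open>K = H + B\<close>, the orthogonal complement of \<open>A\<close>. Inside \<open>K\<close> the
  summands \<open>H\<close> and \<open>B\<close> are the orthogonal complements of each other
  (\<open>orth_compl_of_orthogonal_summand\<close>), so \<open>B\<close> is closed and complemented. Each coset of \<open>B\<close> in \<open>K\<close>
  meets \<open>H\<close> in exactly one point, the projection of the coset to \<open>H\<close>, and sending a coset to this
  point is the isomorphism from cohomology (\<open>quotient_hmodule_iso_orth_compl\<close>).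

  That these modules are complete, and that the adjoint is well defined, depends on the topology:
  \<open>hdist\<close> has to be a metric, orthogonal complements have to be closed, and only zero may be orthogonal
  to a dense set. All of this rests on the Cauchy-Schwarz inequality (\<open>Cauchy_Schwarz\<close>), and that in turn
  on the order of the C*-algebra: the norm is monotone on elements of the form \<open>cstar b * b\<close>.

  The order is developed from the axioms without spectral theory. A self-adjoint element is called
  positive if it lies in a ball of radius \<open>r\<close> around \<open>r 1\<close> for some \<open>r\<close>. Square roots come from the
  iteration \<open>f \<mapsto> (g + f\<^sup>2) / 2\<close>, and commuting self-adjoint \<open>s\<close> and \<open>c\<close> with
  \<open>s\<^sup>2 + c\<^sup>2 = 1\<close> have norm at most 1 because \<open>s + \<i>c\<close> is an isometry. Together these
  show that positive elements are exactly the squares of self-adjoint ones, that they form a cone, that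
  the norm is monotone on it, and that every \<open>cstar b * b\<close> belongs to it
  (\<open>positive_cstar_mult_self\<close>). An algebra without unit is embedded in its multiplier
  algebra.
\<close>

section \<open>Elementary identities in C*-algebras\<close>

lemma cstar_zero [simp]: "cstar (0::'a::cstar_algebra) = 0"
  by (metis add_cancel_right_left cstar_add)

lemma cstar_minus [simp]: "cstar (- x) = - cstar (x::'a::cstar_algebra)"
  by (metis add.right_inverse add_eq_0_iff cstar_add cstar_zero)

lemma cstar_diff: "cstar (x - y) = cstar x - cstar (y::'a::cstar_algebra)"
  by (metis cstar_add cstar_minus diff_conv_add_uminus)

lemma cstar_scaleR: "cstar (r *\<^sub>R x) = r *\<^sub>R cstar (x::'a::cstar_algebra)"
  by (metis complex_cnj_complex_of_real cscaleA_of_real cstar_cscaleA)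

lemma norm_cstar [simp]: "norm (cstar x) = norm (x::'a::cstar_algebra)"
proof -
  have *: "norm y \<le> norm (cstar y)" for y :: 'a
  proof (cases "y = 0")
    case False
    have "norm y * norm y \<le> norm (cstar y) * norm y"
      using norm_mult_ineq[of "cstar y" y] by (simp add: cstar_identity power2_eq_square)
    then show ?thesis using False by simp
  qed simp
  show ?thesis using *[of x] *[of "cstar x"] by (simp add: cstar_cstar)
qed

lemma bounded_linear_cstar: "bounded_linear (cstar :: 'a::cstar_algebra \<Rightarrow> 'a)"
  by (rule bounded_linear_intro[where K=1]) (auto simp: cstar_add cstar_scaleR)

lemma cstar_mult_self_eq_0: "cstar x * x = 0 \<longleftrightarrow> x = (0::'a::cstar_algebra)"
  by (metis cstar_identity mult_zero_right norm_eq_zero power_eq_0_iff)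

lemma selfadjoint_square_eq_0: "cstar x = x \<Longrightarrow> x * x = 0 \<Longrightarrow> x = (0::'a::cstar_algebra)"
  by (metis cstar_mult_self_eq_0)

lemma cscaleA_zero_right [simp]: "cscaleA c (0::'a::cstar_algebra) = 0"
  by (metis add_cancel_right_left cscaleA_add_right)

lemma cscaleA_minus_right: "cscaleA c (- x) = - cscaleA c (x::'a::cstar_algebra)"
  by (metis add.right_inverse add_eq_0_iff cscaleA_add_right cscaleA_zero_right)

lemma cscaleA_diff_right: "cscaleA c (x - y) = cscaleA c x - cscaleA c (y::'a::cstar_algebra)"
  by (metis cscaleA_add_right cscaleA_minus_right diff_conv_add_uminus)

lemma cscaleA_scaleR: "cscaleA c (r *\<^sub>R x) = r *\<^sub>R cscaleA c (x::'a::cstar_algebra)"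
  by (metis cscaleA_cscaleA cscaleA_of_real mult.commute)

lemma cscaleA_ii_ii: "cscaleA \<i> (cscaleA \<i> x) = - (x::'a::cstar_algebra)"
  using cscaleA_of_real[of "-1" x] by (simp add: cscaleA_cscaleA)

lemma cstar_cscaleA_ii: "cstar (cscaleA \<i> x) = - cscaleA \<i> (cstar (x::'a::cstar_algebra))"
proof -
  have "cscaleA (-\<i>) y + cscaleA \<i> y = 0" for y :: 'a
    using cscaleA_add_left[of "-\<i>" \<i> y] cscaleA_of_real[of 0 y] by simp
  then show ?thesis by (simp add: cstar_cscaleA eq_neg_iff_add_eq_0)
qed

text \<open>
  The elements are the real and imaginary parts of \<open>z\<close>, scaled by \<open>sqrt 2\<close>. This identity
  ties \<open>cstar z * z\<close>, of unknown sign, to squares of self-adjoint elements.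
\<close>

lemma cstar_mult_sum_eq_squares:
  fixes z :: "'a::cstar_algebra"
  obtains u v where "cstar u = u" "cstar v = v"
    "cstar z * z + z * cstar z = u * u + v * v"
proof -
  define r where "r = sqrt (1/2)"
  have r2: "r * r = 1/2" by (simp add: r_def)
  define u where "u = r *\<^sub>R (z + cstar z)"
  define v where "v = r *\<^sub>R cscaleA \<i> (cstar z - z)"
  have 1: "cstar u = u" by (simp add: u_def cstar_add cstar_scaleR cstar_cstar add.commute)
  have 2: "cstar v = v"
    by (simp add: v_def cstar_diff cstar_scaleR cstar_cstar cstar_cscaleA_ii
        cscaleA_minus_right[symmetric])
  have "u * u = (r * r) *\<^sub>R ((z + cstar z) * (z + cstar z))"
    by (simp add: u_def)
  moreover have "v * v = (r * r) *\<^sub>R (- ((cstar z - z) * (cstar z - z)))"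
    by (simp add: v_def cscaleA_mult_left cscaleA_mult_right cscaleA_scaleR cscaleA_ii_ii)
  ultimately have "u * u + v * v = (1/2) *\<^sub>R ((z + cstar z) * (z + cstar z) - (cstar z - z) * (cstar z - z))"
    by (simp add: r2 scaleR_diff_right)
  also have "(z + cstar z) * (z + cstar z) - (cstar z - z) * (cstar z - z)
     = 2 *\<^sub>R (cstar z * z + z * cstar z)"
    by (simp add: algebra_simps scaleR_2)
  finally show ?thesis using that 1 2 by simp
qed

section \<open>Square roots in unital C*-algebras\<close>

text \<open>
  \<^class>\<open>monoid_mult\<close> leaves \<open>1 = 0\<close> possible, unlike \<open>ring_1\<close>. This matters below: the
  multiplier algebra of the zero algebra is zero, so one class covers the multiplier algebras of all
  C*-algebras.
\<close>

class unital_cstar_algebra = cstar_algebra + monoid_mult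

lemma cstar_one [simp]: "cstar (1::'a::unital_cstar_algebra) = 1"
  by (metis cstar_cstar cstar_mult mult_1 mult_1_right)

lemma norm_one_le: "norm (1::'a::unital_cstar_algebra) \<le> 1"
  using cstar_identity[of "1::'a"] by (auto simp: power2_eq_square)

text \<open>
  The fixed points \<open>f\<close> of this iteration satisfy \<open>(1 - f)\<^sup>2 = 1 - g\<close>. Its terms are polynomials
  in \<open>g\<close> with nonnegative coefficients, so for \<open>norm g \<le> 1\<close> they and their differences are
  dominated by those of the scalar iteration with \<open>g = 1\<close>, which increases and is bounded by 1. This
  gives convergence on the closed unit ball, including its boundary, where a contraction
  argument would fail.
\<close>

primrec sqrt_iter :: "'a::real_normed_algebra \<Rightarrow> nat \<Rightarrow> 'a" where
  "sqrt_iter g 0 = 0"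
| "sqrt_iter g (Suc n) = (1/2) *\<^sub>R (g + sqrt_iter g n * sqrt_iter g n)"

lemma sqrt_iter_one_bounds: "0 \<le> sqrt_iter (1::real) n \<and> sqrt_iter (1::real) n \<le> 1"
proof (induction n)
  case (Suc n)
  then show ?case using mult_le_one[of "sqrt_iter 1 n" "sqrt_iter (1::real) n"] by simp
qed simp

lemma norm_sqrt_iter_le:
  assumes "norm g \<le> 1"
  shows "norm (sqrt_iter g n) \<le> sqrt_iter 1 n"
proof (induction n)
  case (Suc n)
  have "norm (sqrt_iter g n * sqrt_iter g n) \<le> sqrt_iter 1 n * sqrt_iter 1 n"
    by (rule order_trans[OF norm_mult_ineq]) (intro mult_mono Suc norm_ge_zero, simp add: sqrt_iter_one_bounds)
  then show ?case using assms norm_triangle_ineq[of g "sqrt_iter g n * sqrt_iter g n"] by simp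
qed simp

lemma norm_sqrt_iter_step_le:
  assumes "norm g \<le> 1"
  shows "norm (sqrt_iter g (Suc n) - sqrt_iter g n) \<le> sqrt_iter 1 (Suc n) - sqrt_iter 1 n"
proof (induction n)
  case 0
  then show ?case using assms by simp
next
  case (Suc n)
  define p q where "p = sqrt_iter g (Suc n)" and "q = sqrt_iter g n"
  define a b where "a = sqrt_iter (1::real) (Suc n)" and "b = sqrt_iter (1::real) n"
  have p: "norm p \<le> a" and q: "norm q \<le> b" and pq: "norm (p - q) \<le> a - b"
    using norm_sqrt_iter_le[OF assms] Suc by (auto simp: p_def q_def a_def b_def simp del: sqrt_iter.simps)
  have a0: "0 \<le> a" and b0: "0 \<le> b" by (auto simp: a_def b_def sqrt_iter_one_bounds simp del: sqrt_iter.simps)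
  have "sqrt_iter g (Suc (Suc n)) - sqrt_iter g (Suc n) = (1/2) *\<^sub>R (p * p - q * q)"
    by (simp add: p_def q_def algebra_simps)
  also have "p * p - q * q = p * (p - q) + (p - q) * q" by (simp add: algebra_simps)
  also have "norm ((1/2) *\<^sub>R (p * (p - q) + (p - q) * q)) \<le> (1/2) * (a * (a - b) + (a - b) * b)"
  proof -
    have "norm (p * (p - q)) \<le> a * (a - b)"
      by (rule order_trans[OF norm_mult_ineq]) (intro mult_mono p pq a0 norm_ge_zero)
    moreover have "norm ((p - q) * q) \<le> (a - b) * b"
      by (rule order_trans[OF norm_mult_ineq]) (intro mult_mono q pq norm_ge_zero order_trans[OF norm_ge_zero pq])
    ultimately show ?thesis using norm_triangle_ineq[of "p * (p - q)" "(p - q) * q"] by simp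
  qed
  also have "\<dots> = sqrt_iter 1 (Suc (Suc n)) - sqrt_iter 1 (Suc n)"
    by (simp add: a_def b_def algebra_simps)
  finally show ?case .
qed

lemma sqrt_iter_convergent:
  fixes g :: "'a::{real_normed_algebra, banach}"
  assumes "norm g \<le> 1"
  shows "convergent (sqrt_iter g)"
proof -
  have step: "sqrt_iter (1::real) n \<le> sqrt_iter 1 (Suc n)" for n
    using norm_sqrt_iter_step_le[of "1::real" n] by (simp del: sqrt_iter.simps)
  have "convergent (sqrt_iter (1::real))"
  proof (rule Bseq_monoseq_convergent)
    show "Bseq (sqrt_iter (1::real))"
      by (rule BseqI'[of _ 1]) (simp add: sqrt_iter_one_bounds)
    show "monoseq (sqrt_iter (1::real))" by (rule mono_SucI1) (use step in auto)
  qed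
  then have "summable (\<lambda>n. sqrt_iter (1::real) (Suc n) - sqrt_iter 1 n)"
    unfolding convergent_def by (metis sums_summable telescope_sums)
  then have "summable (\<lambda>n. sqrt_iter g (Suc n) - sqrt_iter g n)"
    by (rule summable_comparison_test'[where N=0]) (rule norm_sqrt_iter_step_le[OF assms])
  then have "convergent (\<lambda>n. \<Sum>k<n. sqrt_iter g (Suc k) - sqrt_iter g k)"
    by (simp add: summable_iff_convergent)
  then show ?thesis by (simp add: sum_lessThan_telescope del: sqrt_iter.simps(2))
qed

text \<open>
  The limit inherits self-adjointness and the commutation property from the terms of the iteration,
  which are polynomials in \<open>g\<close>.
\<close>

lemma exists_sqrt_one_minus:
  fixes g :: "'a::unital_cstar_algebra"
  assumes g: "norm g \<le> 1" "cstar g = g"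
  obtains f where "norm f \<le> 1" "cstar f = f" "(1 - f) * (1 - f) = 1 - g"
    "\<And>z. z * g = g * z \<Longrightarrow> z * f = f * z"
proof -
  obtain f where f: "sqrt_iter g \<longlonglongrightarrow> f"
    using sqrt_iter_convergent[OF g(1)] by (auto simp: convergent_def)
  have "norm (sqrt_iter g n) \<le> 1" for n
    using norm_sqrt_iter_le[OF g(1), of n] sqrt_iter_one_bounds[of n] by linarith
  then have 1: "norm f \<le> 1"
    using Lim_bounded[OF tendsto_norm[OF f], of 0 1] by auto
  have "cstar (sqrt_iter g n) = sqrt_iter g n" for n
    by (induction n) (auto simp: cstar_scaleR cstar_add cstar_mult g)
  then have "sqrt_iter g \<longlonglongrightarrow> cstar f"
    using bounded_linear.tendsto[OF bounded_linear_cstar f] by simp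
  then have 2: "cstar f = f" using f LIMSEQ_unique by blast
  have "(\<lambda>n. sqrt_iter g (Suc n)) \<longlonglongrightarrow> (1/2) *\<^sub>R (g + f * f)"
    unfolding sqrt_iter.simps by (intro tendsto_intros f)
  then have "f = (1/2) *\<^sub>R (g + f * f)" using LIMSEQ_Suc[OF f] LIMSEQ_unique by blast
  then have "f + f = g + f * f" by (metis field_sum_of_halves scaleR_left_distrib scaleR_one scaleR_right_distrib)
  then have 3: "(1 - f) * (1 - f) = 1 - g" by (simp add: algebra_simps)
  have 4: "z * f = f * z" if z: "z * g = g * z" for z
  proof -
    have "z * sqrt_iter g n = sqrt_iter g n * z" for n
    proof (induction n)
      case (Suc n)
      then have "z * (sqrt_iter g n * sqrt_iter g n) = sqrt_iter g n * sqrt_iter g n * z"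
        by (metis mult.assoc)
      then show ?case by (simp add: z distrib_left distrib_right)
    qed simp
    moreover have "(\<lambda>n. z * sqrt_iter g n) \<longlonglongrightarrow> z * f" "(\<lambda>n. sqrt_iter g n * z) \<longlonglongrightarrow> f * z"
      by (intro tendsto_intros f)+
    ultimately show ?thesis using LIMSEQ_unique by auto
  qed
  show ?thesis using that 1 2 3 4 by blast
qed

text \<open>
  A cosine is bounded by one: \<open>s + \<i>c\<close> is an isometry because \<open>s\<close> and \<open>c\<close> commute, and
  \<open>s\<close> is its real part.
\<close>

lemma norm_le_one_of_sum_squares_eq_one:
  fixes s c :: "'a::unital_cstar_algebra"
  assumes s: "cstar s = s" and c: "cstar c = c" and comm: "s * c = c * s"
    and sum: "s * s + c * c = 1"
  shows "norm s \<le> 1"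
proof -
  define u where "u = s + cscaleA \<i> c"
  have cu: "cstar u = s - cscaleA \<i> c"
    by (simp add: u_def cstar_add cstar_cscaleA_ii s c)
  have "cstar u * u = s * s - cscaleA \<i> (cscaleA \<i> (c * c))"
    unfolding cu unfolding u_def
    by (simp add: distrib_left left_diff_distrib cscaleA_add_right cscaleA_diff_right cscaleA_mult_left
        cscaleA_mult_right comm)
  then have "cstar u * u = 1" by (simp add: cscaleA_ii_ii sum)
  then have "(norm u)\<^sup>2 \<le> 1" by (metis cstar_identity norm_one_le)
  then have "norm u \<le> 1" by (simp add: abs_square_le_1 power_le_one_iff)
  moreover have "2 *\<^sub>R s = u + cstar u" unfolding cu unfolding u_def by (simp add: scaleR_2)
  then have "2 * norm s \<le> norm u + norm (cstar u)"
    using norm_triangle_ineq[of u "cstar u"] by (metis abs_numeral norm_scaleR)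
  ultimately show ?thesis by simp
qed

section \<open>Positive elements of unital C*-algebras\<close>

text \<open>
  For self-adjoint \<open>h\<close> this is nonnegativity of the spectrum, expressed through the norm: the
  spectrum lies in an interval \<open>[0, 2r]\<close>. In this form the triangle inequality alone
  shows that positive elements are closed under addition.
\<close>

definition positive :: "'a::unital_cstar_algebra \<Rightarrow> bool"
  where "positive h \<longleftrightarrow> cstar h = h \<and> (\<exists>r. norm (r *\<^sub>R 1 - h) \<le> r)"

lemma positive_add:
  assumes "positive h" "positive k"
  shows "positive (h + k)"
proof -
  obtain r q where "norm (r *\<^sub>R 1 - h) \<le> r" "norm (q *\<^sub>R 1 - k) \<le> q"
    using assms by (auto simp: positive_def)
  then have "norm ((r + q) *\<^sub>R 1 - (h + k)) \<le> r + q"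
    using norm_triangle_ineq[of "r *\<^sub>R 1 - h" "q *\<^sub>R 1 - k"] by (simp add: algebra_simps)
  then show ?thesis using assms by (auto simp: positive_def cstar_add)
qed

text \<open>
  After scaling to \<open>r = 1\<close>, the element \<open>1 - s\<^sup>2\<close> is the square of a self-adjoint \<open>c\<close> that
  commutes with \<open>s\<close>, and \<open>c\<close> has norm at most one since \<open>c\<^sup>2 + s\<^sup>2 = 1\<close>.
\<close>

lemma norm_diff_square_le:
  fixes s :: "'a::unital_cstar_algebra"
  assumes s: "cstar s = s" and r: "0 < r" and le: "(norm s)\<^sup>2 \<le> r"
  shows "norm (r *\<^sub>R 1 - s * s) \<le> r"
proof -
  define g where "g = (1/r) *\<^sub>R (s * s)"
  have "norm (s * s) = (norm s)\<^sup>2" using cstar_identity[of s] s by simp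
  then have g: "norm g \<le> 1" "cstar g = g"
    using r le s by (auto simp: g_def divide_simps cstar_scaleR cstar_mult)
  obtain f where f: "cstar f = f" "(1 - f) * (1 - f) = 1 - g"
    "\<And>z. z * g = g * z \<Longrightarrow> z * f = f * z"
    using exists_sqrt_one_minus[OF g] by metis
  define q where "q = (1 / sqrt r) *\<^sub>R s"
  have "s * g = g * s" by (simp add: g_def mult.assoc)
  then have "s * f = f * s" by (rule f)
  then have "(1 - f) * q = q * (1 - f)" by (simp add: q_def algebra_simps)
  moreover have "q * q = g" using r by (simp add: q_def g_def)
  ultimately have "norm (1 - f) \<le> 1"
    using norm_le_one_of_sum_squares_eq_one[of "1 - f" q] f(1,2) s
    by (simp add: q_def cstar_diff cstar_scaleR)
  then have "norm ((1 - f) * (1 - f)) \<le> 1"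
    by (metis mult_le_one norm_ge_zero norm_mult_ineq order_trans)
  then have "norm (r *\<^sub>R (1 - g)) \<le> r" using r f(2) by simp
  then show ?thesis using r by (simp add: g_def scaleR_diff_right)
qed

lemma positive_square:
  fixes s :: "'a::unital_cstar_algebra"
  assumes "cstar s = s"
  shows "positive (s * s)"
  using norm_diff_square_le[OF assms, of "(norm s)\<^sup>2 + 1"] assms
  by (auto simp: positive_def cstar_mult add_nonneg_pos)

lemma positive_sqrt:
  fixes h :: "'a::unital_cstar_algebra"
  assumes "positive h"
  obtains s where "positive s" "s * s = h" "\<And>z. z * h = h * z \<Longrightarrow> z * s = s * z"
proof -
  obtain r where r: "norm (r *\<^sub>R 1 - h) \<le> r" and h: "cstar h = h"
    using assms by (auto simp: positive_def)
  then have "0 \<le> r" using norm_ge_zero order_trans by blast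
  then consider "r = 0" | "0 < r" by linarith
  then show ?thesis
  proof cases
    case 1
    then show ?thesis using that[of h] r assms by simp
  next
    case 2
    define g where "g = 1 - (1/r) *\<^sub>R h"
    have "r *\<^sub>R g = r *\<^sub>R 1 - h" using 2 by (simp add: g_def scaleR_diff_right)
    then have "r * norm g \<le> r" using r 2 by (metis abs_of_pos norm_scaleR)
    then have g: "norm g \<le> 1" "cstar g = g"
      using 2 h by (auto simp: g_def cstar_diff cstar_scaleR)
    obtain f where f: "norm f \<le> 1" "cstar f = f" "(1 - f) * (1 - f) = 1 - g"
      "\<And>z. z * g = g * z \<Longrightarrow> z * f = f * z"
      using exists_sqrt_one_minus[OF g] by metis
    define s where "s = sqrt r *\<^sub>R (1 - f)"
    have "norm (sqrt r *\<^sub>R 1 - s) = sqrt r * norm f" using 2 by (simp add: s_def scaleR_diff_right)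
    also have "\<dots> \<le> sqrt r" using f(1) 2 by (simp add: mult_left_le)
    finally have "positive s" using f(2) by (auto simp: positive_def s_def cstar_scaleR cstar_diff)
    moreover have "s * s = h" using 2 f(3) by (simp add: s_def g_def)
    moreover have "z * s = s * z" if "z * h = h * z" for z
    proof -
      have "z * g = g * z" using that by (simp add: g_def algebra_simps)
      then show ?thesis using f(4) by (simp add: s_def algebra_simps)
    qed
    ultimately show ?thesis using that by blast
  qed
qed

text \<open>
  For \<open>r\<close> slightly larger than \<open>norm (h + k)\<close>, both \<open>h\<close> and \<open>r - h\<close> are positive. Their square
  roots commute and, divided by \<open>sqrt r\<close>, have squares with sum 1, so each has norm at most 1.
\<close>

lemma positive_norm_mono:
  fixes h k :: "'a::unital_cstar_algebra"
  assumes h: "positive h" and k: "positive k"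
  shows "norm h \<le> norm (h + k)"
proof (rule field_le_epsilon)
  fix e :: real assume "0 < e"
  define r where "r = norm (h + k) + e"
  have r: "0 < r" "norm (h + k) \<le> r" using \<open>0 < e\<close> by (auto simp: r_def add_nonneg_pos)
  have sa: "cstar h = h" "cstar k = k" using h k by (auto simp: positive_def)
  have "positive (r *\<^sub>R 1 - (h + k))"
    using r(2) sa unfolding positive_def
    by (intro conjI exI[of _ r]) (simp_all add: cstar_diff cstar_add cstar_scaleR add.commute)
  then have "positive (r *\<^sub>R 1 - h)"
    using positive_add[OF _ k] by fastforce
  then obtain w where w: "positive w" "w * w = r *\<^sub>R 1 - h"
    "\<And>z. z * (r *\<^sub>R 1 - h) = (r *\<^sub>R 1 - h) * z \<Longrightarrow> z * w = w * z"
    using positive_sqrt by metis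
  obtain s where s: "positive s" "s * s = h" using positive_sqrt[OF h] by metis
  have "s * h = h * s" by (metis s(2) mult.assoc)
  then have "s * w = w * s" by (intro w(3)) (simp add: algebra_simps)
  define c where "c = 1 / sqrt r"
  have "norm (c *\<^sub>R s) \<le> 1"
  proof (rule norm_le_one_of_sum_squares_eq_one[where c = "c *\<^sub>R w"])
    have "c *\<^sub>R s * c *\<^sub>R s + c *\<^sub>R w * c *\<^sub>R w = (c * c) *\<^sub>R (s * s + w * w)"
      by (simp add: scaleR_add_right)
    also have "\<dots> = (c * c * r) *\<^sub>R 1" by (simp add: s(2) w(2))
    also have "c * c * r = 1" using r by (simp add: c_def)
    finally show "c *\<^sub>R s * c *\<^sub>R s + c *\<^sub>R w * c *\<^sub>R w = 1" by simp
  qed (use s w(1) \<open>s * w = w * s\<close> in \<open>auto simp: positive_def cstar_scaleR\<close>)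
  then have "norm s \<le> sqrt r" using r by (simp add: c_def divide_simps)
  then have "norm s * norm s \<le> r" using r
    by (metis mult_mono norm_ge_zero real_sqrt_ge_zero less_imp_le real_sqrt_mult_self abs_of_pos)
  then show "norm h \<le> norm (h + k) + e"
    using norm_mult_ineq[of s s] s(2) unfolding r_def by simp
qed

lemma positive_add_eq_0:
  fixes h k :: "'a::unital_cstar_algebra"
  assumes "positive h" "positive k" "h + k = 0"
  shows "h = 0"
  using positive_norm_mono[OF assms(1,2)] assms(3) by simp

text \<open>
  With \<open>z = y m\<close>, both \<open>cstar z * z\<close> and \<open>z * cstar z\<close> are negatives of squares of self-adjoint
  elements, whereas their sum is a sum of such squares. So a sum of positive elements vanishes, and
  hence each of them does, in particular \<open>m\<^sup>4\<close>.
\<close>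

lemma cstar_mult_self_eq_minus_square:
  fixes y m :: "'a::unital_cstar_algebra"
  assumes m: "cstar m = m" and y: "cstar y * y = - (m * m)"
  shows "y = 0"
proof -
  define z where "z = y * m"
  obtain u v where uv: "cstar u = u" "cstar v = v"
    "cstar z * z + z * cstar z = u * u + v * v"
    using cstar_mult_sum_eq_squares by blast
  have "cstar z * z = m * (cstar y * y) * m" by (simp add: z_def cstar_mult m mult.assoc)
  then have 1: "cstar z * z = - ((m * m) * (m * m))" by (simp add: y mult.assoc)
  have "z * cstar z = - (y * (- (m * m)) * cstar y)" by (simp add: z_def cstar_mult m mult.assoc)
  also have "\<dots> = - ((y * cstar y) * (y * cstar y))" by (simp only: y[symmetric] mult.assoc)
  finally have 2: "z * cstar z = - ((y * cstar y) * (y * cstar y))" .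
  have "(m * m) * (m * m) + ((y * cstar y) * (y * cstar y) + (u * u + v * v)) = 0"
    using uv(3) 1 2 by (metis (no_types, lifting) add.assoc add.commute add.right_inverse add.inverse_inverse minus_add_distrib)
  moreover have "positive ((m * m) * (m * m))"
    by (intro positive_square) (simp add: cstar_mult m)
  moreover have "positive ((y * cstar y) * (y * cstar y) + (u * u + v * v))"
    by (intro positive_add positive_square uv) (simp add: cstar_mult cstar_cstar)
  ultimately have "(m * m) * (m * m) = 0" using positive_add_eq_0 by blast
  then have "m * m = 0" using selfadjoint_square_eq_0[of "m * m"] m by (simp add: cstar_mult)
  then show ?thesis using y by (simp add: cstar_mult_self_eq_0)
qed

text \<open>
  The theorem of Fukamachi, Kelley and Vaught, by Kaplansky's argument. Let \<open>k\<close> be the absolute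
  value of \<open>h = cstar b * b\<close>, so that \<open>n = k - h\<close> is twice the negative part of \<open>h\<close>. Then
  \<open>b n\<close> is an element \<open>y\<close> with \<open>cstar y * y\<close> the negative of a square; hence it is zero, the
  negative part vanishes, and \<open>h = k\<close>.
\<close>

theorem positive_cstar_mult_self:
  fixes b :: "'a::unital_cstar_algebra"
  shows "positive (cstar b * b)"
proof -
  define h where "h = cstar b * b"
  have h: "cstar h = h" by (simp add: h_def cstar_mult cstar_cstar)
  obtain k where k: "positive k" "k * k = h * h" "\<And>z. z * (h * h) = (h * h) * z \<Longrightarrow> z * k = k * z"
    using positive_sqrt[OF positive_square[OF h]] by metis
  have hk: "h * k = k * h" by (rule k(3)) (simp add: mult.assoc)
  obtain q where q: "positive q" "q * q = k" "\<And>z. z * k = k * z \<Longrightarrow> z * q = q * z"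
    using positive_sqrt[OF k(1)] by metis
  have sa: "cstar k = k" "cstar q = q" using k(1) q(1) by (auto simp: positive_def)
  define n where "n = k - h"
  have n: "cstar n = n" by (simp add: n_def cstar_diff h sa)
  have hn: "h * n = - (k * n)" by (simp add: n_def algebra_simps k hk)
  have nq: "n * q = q * n" by (rule q(3)) (simp add: n_def algebra_simps hk)
  have "cstar (b * n) * (b * n) = n * (h * n)"
    by (simp add: cstar_mult n h_def mult.assoc)
  also have "\<dots> = - ((n * q) * (q * n))" by (simp add: hn mult.assoc flip: q(2))
  also have "\<dots> = - ((q * n) * (q * n))" by (simp add: nq)
  finally have "b * n = 0"
    by (rule cstar_mult_self_eq_minus_square[rotated]) (simp add: cstar_mult n sa nq)
  then have "h * n = 0" by (simp add: h_def mult.assoc)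
  moreover have "n * n = k * n - h * n" by (simp add: n_def algebra_simps)
  ultimately have "n * n = 0" using hn by simp
  then have "n = 0" using selfadjoint_square_eq_0 n by blast
  then show ?thesis using k(1) by (simp add: n_def h_def)
qed

lemma positive_conjugate:
  fixes p a :: "'a::unital_cstar_algebra"
  assumes "positive p"
  shows "positive (cstar a * p * a)"
proof -
  obtain s where s: "positive s" "s * s = p" using positive_sqrt[OF assms] by metis
  then have "cstar a * p * a = cstar (s * a) * (s * a)"
    by (auto simp: cstar_mult positive_def mult.assoc)
  then show ?thesis by (simp only: positive_cstar_mult_self)
qed

text \<open>
  The identity says that \<open>cstar d * d\<close> is the sum of \<open>cstar a * a\<close>, of \<open>cstar c * c\<close> and of
  the conjugate of \<open>1 - cstar b * b\<close> by \<open>a\<close>. This is the form in which positivity enters the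
  Cauchy-Schwarz inequality; it mentions neither the unit nor an order, and so carries over to
  algebras without unit.
\<close>

lemma unital_norm_le_of_positive_identity:
  fixes a b c d :: "'a::unital_cstar_algebra"
  assumes b: "norm b \<le> 1"
    and eq: "cstar d * d + cstar a * (cstar b * b) * a = cstar c * c + (cstar a * a + cstar a * a)"
  shows "norm a \<le> norm d"
proof -
  have "norm (cstar b * b) \<le> 1" using b by (simp add: cstar_identity power_le_one)
  then have "positive (1 - cstar b * b)"
    by (auto simp: positive_def cstar_diff cstar_mult cstar_cstar intro!: exI[of _ 1])
  then have "positive (cstar c * c + cstar a * (1 - cstar b * b) * a)"
    by (intro positive_add positive_conjugate positive_cstar_mult_self)
  moreover have "cstar d * d = cstar a * a + (cstar c * c + cstar a * (1 - cstar b * b) * a)"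
    using eq by (simp add: algebra_simps)
  ultimately have "norm (cstar a * a) \<le> norm (cstar d * d)"
    by (metis positive_norm_mono positive_cstar_mult_self)
  then show ?thesis by (simp add: cstar_identity)
qed

section \<open>The multiplier algebra\<close>

definition adjoint_ops :: "('a::cstar_algebra \<Rightarrow>\<^sub>L 'a) \<Rightarrow> ('a \<Rightarrow>\<^sub>L 'a) \<Rightarrow> bool"
  where "adjoint_ops T S \<longleftrightarrow> (\<forall>x y. cstar (blinfun_apply T x) * y = cstar x * blinfun_apply S y)"

lemma adjoint_opsD: "adjoint_ops T S \<Longrightarrow> cstar (blinfun_apply T x) * y = cstar x * blinfun_apply S y"
  by (simp add: adjoint_ops_def)

lemma adjoint_ops_sym:
  assumes "adjoint_ops T S"
  shows "adjoint_ops S T"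
proof -
  have "cstar (cstar (blinfun_apply T y) * x) = cstar (cstar y * blinfun_apply S x)" for x y
    using adjoint_opsD[OF assms] by simp
  then show ?thesis by (simp add: adjoint_ops_def cstar_mult cstar_cstar)
qed

text \<open>
  The C*-identity of the multiplier algebra, inherited from that of the algebra:
  \<open>norm (T x)\<^sup>2 = norm (cstar x * S (T x))\<close>.
\<close>

lemma adjoint_ops_norm_square_le:
  assumes "adjoint_ops T S"
  shows "(norm T)\<^sup>2 \<le> norm (S o\<^sub>L T)"
proof -
  have "norm (blinfun_apply T x) \<le> sqrt (norm (S o\<^sub>L T)) * norm x" for x
  proof (rule power2_le_imp_le)
    have "(norm (blinfun_apply T x))\<^sup>2 = norm (cstar x * blinfun_apply (S o\<^sub>L T) x)"
      using adjoint_opsD[OF assms, of x "blinfun_apply T x"] by (simp flip: cstar_identity)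
    also have "\<dots> \<le> norm x * (norm (S o\<^sub>L T) * norm x)"
      by (rule order_trans[OF norm_mult_ineq], rule mult_mono)
        (simp_all add: norm_blinfun del: blinfun_apply_blinfun_compose)
    also have "\<dots> = (sqrt (norm (S o\<^sub>L T)) * norm x)\<^sup>2"
      by (simp add: power_mult_distrib power2_eq_square[of "norm x"] mult_ac)
    finally show "(norm (blinfun_apply T x))\<^sup>2 \<le> (sqrt (norm (S o\<^sub>L T)) * norm x)\<^sup>2" .
  qed simp
  then have "norm T \<le> sqrt (norm (S o\<^sub>L T))" by (intro norm_blinfun_bound) auto
  then show ?thesis using power_mono[of "norm T" "sqrt (norm (S o\<^sub>L T))" 2] by simp
qed

lemma adjoint_ops_norm_eq:
  assumes "adjoint_ops T S"
  shows "norm S = norm T"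
proof -
  have *: "norm T \<le> norm S" if "adjoint_ops T S" for T S :: "'a \<Rightarrow>\<^sub>L 'a"
  proof (cases "T = 0")
    case False
    have "norm T * norm T \<le> norm S * norm T"
      using adjoint_ops_norm_square_le[OF that] norm_blinfun_compose[of S T]
      by (simp add: power2_eq_square)
    then show ?thesis using False by simp
  qed simp
  show ?thesis using *[OF assms] *[OF adjoint_ops_sym[OF assms]] by simp
qed

lemma adjoint_ops_diff:
  "adjoint_ops T S \<Longrightarrow> adjoint_ops T' S' \<Longrightarrow> adjoint_ops (T - T') (S - S')"
  by (simp add: adjoint_ops_def blinfun.diff_left cstar_diff algebra_simps)

lemma adjoint_ops_add:
  "adjoint_ops T S \<Longrightarrow> adjoint_ops T' S' \<Longrightarrow> adjoint_ops (T + T') (S + S')"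
  by (simp add: adjoint_ops_def blinfun.add_left cstar_add algebra_simps)

lemma adjoint_ops_zero: "adjoint_ops 0 0"
  by (simp add: adjoint_ops_def)

lemma adjoint_ops_minus: "adjoint_ops T S \<Longrightarrow> adjoint_ops (- T) (- S)"
  using adjoint_ops_diff[OF adjoint_ops_zero, of T S] by simp

lemma adjoint_ops_scaleR: "adjoint_ops T S \<Longrightarrow> adjoint_ops (r *\<^sub>R T) (r *\<^sub>R S)"
  by (simp add: adjoint_ops_def blinfun.scaleR_left cstar_scaleR)

lemma adjoint_ops_compose:
  "adjoint_ops T S \<Longrightarrow> adjoint_ops T' S' \<Longrightarrow> adjoint_ops (T o\<^sub>L T') (S' o\<^sub>L S)"
  by (simp add: adjoint_ops_def)

lemma adjoint_ops_id: "adjoint_ops id_blinfun id_blinfun"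
  by (simp add: adjoint_ops_def)

lemma adjoint_ops_unique:
  assumes "adjoint_ops T S" "adjoint_ops T S'"
  shows "S = S'"
  using adjoint_ops_norm_eq[OF adjoint_ops_diff[OF assms]] by simp

lemma bounded_linear_cscaleA: "bounded_linear (cscaleA c :: 'a::cstar_algebra \<Rightarrow> 'a)"
  by (rule bounded_linear_intro[where K="cmod c"])
    (auto simp: cscaleA_add_right cscaleA_scaleR norm_cscaleA mult.commute)

definition blinfun_cscale :: "complex \<Rightarrow> ('b::real_normed_vector \<Rightarrow>\<^sub>L 'a::cstar_algebra) \<Rightarrow> ('b \<Rightarrow>\<^sub>L 'a)"
  where "blinfun_cscale c T = Blinfun (cscaleA c) o\<^sub>L T"

lemma blinfun_cscale_apply [simp]:
  "blinfun_apply (blinfun_cscale c T) x = cscaleA c (blinfun_apply T x)"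
  by (simp add: blinfun_cscale_def bounded_linear_Blinfun_apply bounded_linear_cscaleA)

lemma cscaleA_one [simp]: "cscaleA 1 x = (x::'a::cstar_algebra)"
  using cscaleA_of_real[of 1 x] by simp

lemma norm_blinfun_cscale:
  fixes T :: "'b::real_normed_vector \<Rightarrow>\<^sub>L 'a::cstar_algebra"
  shows "norm (blinfun_cscale c T) = cmod c * norm T"
proof -
  have *: "norm (blinfun_cscale c T) \<le> cmod c * norm T" for c and T :: "'b \<Rightarrow>\<^sub>L 'a"
    by (rule norm_blinfun_bound)
      (simp_all add: norm_cscaleA mult.assoc mult_left_mono norm_blinfun)
  show ?thesis
  proof (cases "c = 0")
    case False
    have "T = blinfun_cscale (inverse c) (blinfun_cscale c T)"
      using False by (intro blinfun_eqI) (simp add: cscaleA_cscaleA)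
    then have "norm T \<le> inverse (cmod c) * norm (blinfun_cscale c T)"
      using *[of "inverse c" "blinfun_cscale c T"] by (simp add: norm_inverse)
    then show ?thesis using *[of c T] False by (simp add: field_simps)
  qed (use *[of c T] in simp)
qed

lemma adjoint_ops_cscale:
  "adjoint_ops T S \<Longrightarrow> adjoint_ops (blinfun_cscale c T) (blinfun_cscale (cnj c) S)"
  by (simp add: adjoint_ops_def cstar_cscaleA cscaleA_mult_left cscaleA_mult_right)

text \<open>
  Passing to the adjoint preserves norms, so the adjoints of a convergent sequence form a Cauchy
  sequence. This makes the multiplier algebra complete.
\<close>

lemma adjoint_ops_limit:
  assumes TS: "\<And>n. adjoint_ops (T n) (S n)" and T: "T \<longlonglongrightarrow> T0"
  shows "\<exists>S0. adjoint_ops T0 S0"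
proof -
  have "norm (S m - S n) = norm (T m - T n)" for m n
    by (intro adjoint_ops_norm_eq adjoint_ops_diff TS)
  then have "Cauchy S" using LIMSEQ_imp_Cauchy[OF T] by (simp add: Cauchy_def dist_norm)
  then obtain S0 where S: "S \<longlonglongrightarrow> S0" using Cauchy_convergent_iff convergent_def by blast
  have "cstar (blinfun_apply T0 x) * y = cstar x * blinfun_apply S0 y" for x y
  proof (rule LIMSEQ_unique)
    show "(\<lambda>n. cstar (blinfun_apply (T n) x) * y) \<longlonglongrightarrow> cstar (blinfun_apply T0 x) * y"
      by (intro tendsto_intros bounded_linear.tendsto[OF bounded_linear_cstar] T)
    show "(\<lambda>n. cstar (blinfun_apply (T n) x) * y) \<longlonglongrightarrow> cstar x * blinfun_apply S0 y"
      unfolding adjoint_opsD[OF TS] by (intro tendsto_intros S)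
  qed
  then show ?thesis by (auto simp: adjoint_ops_def)
qed

text \<open>
  The adjointable operators of the algebra, regarded as a Hilbert module over itself, form a unital
  C*-algebra that contains it isometrically. In contrast to the algebra with a unit adjoined, its norm
  is an operator norm whether or not the algebra already has a unit.
\<close>

typedef (overloaded) 'a multiplier = "{T :: 'a::cstar_algebra \<Rightarrow>\<^sub>L 'a. \<exists>S. adjoint_ops T S}"
  using adjoint_ops_zero by blast

setup_lifting type_definition_multiplier

instantiation multiplier :: (cstar_algebra) real_normed_algebra
begin

lift_definition zero_multiplier :: "'a multiplier" is 0 using adjoint_ops_zero by blast
lift_definition plus_multiplier :: "'a multiplier \<Rightarrow> 'a multiplier \<Rightarrow> 'a multiplier" is "(+)"
  using adjoint_ops_add by blast
lift_definition uminus_multiplier :: "'a multiplier \<Rightarrow> 'a multiplier" is uminus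
  using adjoint_ops_minus by blast
lift_definition minus_multiplier :: "'a multiplier \<Rightarrow> 'a multiplier \<Rightarrow> 'a multiplier" is "(-)"
  using adjoint_ops_diff by blast
lift_definition scaleR_multiplier :: "real \<Rightarrow> 'a multiplier \<Rightarrow> 'a multiplier" is scaleR
  using adjoint_ops_scaleR by blast
lift_definition times_multiplier :: "'a multiplier \<Rightarrow> 'a multiplier \<Rightarrow> 'a multiplier"
  is "(o\<^sub>L)"
  using adjoint_ops_compose by blast
lift_definition norm_multiplier :: "'a multiplier \<Rightarrow> real" is norm .
lift_definition sgn_multiplier :: "'a multiplier \<Rightarrow> 'a multiplier" is sgn
  unfolding sgn_div_norm using adjoint_ops_scaleR by blast
lift_definition dist_multiplier :: "'a multiplier \<Rightarrow> 'a multiplier \<Rightarrow> real" is dist .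

definition uniformity_multiplier :: "('a multiplier \<times> 'a multiplier) filter"
  where "uniformity_multiplier = (INF e\<in>{0<..}. principal {(x, y). dist x y < e})"
definition open_multiplier :: "'a multiplier set \<Rightarrow> bool"
  where "open_multiplier U = (\<forall>x\<in>U. \<forall>\<^sub>F (x', y) in uniformity. x' = x \<longrightarrow> y \<in> U)"

instance
proof
  fix a b c :: "'a multiplier" and r q :: real
  show "a + b + c = a + (b + c)" by transfer simp
  show "a + b = b + a" by transfer simp
  show "0 + a = a" by transfer simp
  show "- a + a = 0" by transfer simp
  show "a - b = a + - b" by transfer simp
  show "r *\<^sub>R (a + b) = r *\<^sub>R a + r *\<^sub>R b" by transfer (simp add: scaleR_add_right)
  show "(r + q) *\<^sub>R a = r *\<^sub>R a + q *\<^sub>R a" by transfer (simp add: scaleR_add_left)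
  show "r *\<^sub>R q *\<^sub>R a = (r * q) *\<^sub>R a" by transfer simp
  show "1 *\<^sub>R a = a" by transfer simp
  show "a * b * c = a * (b * c)" by transfer (simp add: blinfun_eqI)
  show "(a + b) * c = a * c + b * c" by transfer (simp add: blinfun_eqI blinfun.bilinear_simps)
  show "a * (b + c) = a * b + a * c" by transfer (simp add: blinfun_eqI blinfun.bilinear_simps)
  show "r *\<^sub>R a * b = r *\<^sub>R (a * b)" by transfer (simp add: blinfun_eqI blinfun.bilinear_simps)
  show "a * r *\<^sub>R b = r *\<^sub>R (a * b)" by transfer (simp add: blinfun_eqI blinfun.bilinear_simps)
  show "sgn a = inverse (norm a) *\<^sub>R a" by transfer (simp add: sgn_div_norm)
  show "dist a b = norm (a - b)" by transfer (simp add: dist_norm)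
  show "norm a = 0 \<longleftrightarrow> a = 0" by transfer simp
  show "norm (a + b) \<le> norm a + norm b" by transfer (rule norm_triangle_ineq)
  show "norm (r *\<^sub>R a) = \<bar>r\<bar> * norm a" by transfer simp
  show "norm (a * b) \<le> norm a * norm b" by transfer (rule norm_blinfun_compose)
qed (fact uniformity_multiplier_def open_multiplier_def)+

end

instantiation multiplier :: (cstar_algebra) unital_cstar_algebra
begin

lift_definition one_multiplier :: "'a multiplier" is id_blinfun
  using adjoint_ops_id by blast
lift_definition cscaleA_multiplier :: "complex \<Rightarrow> 'a multiplier \<Rightarrow> 'a multiplier" is blinfun_cscale
  using adjoint_ops_cscale by blast
lift_definition cstar_multiplier :: "'a multiplier \<Rightarrow> 'a multiplier" is "\<lambda>T. THE S. adjoint_ops T S"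
proof -
  fix T :: "'a \<Rightarrow>\<^sub>L 'a" assume "\<exists>S. adjoint_ops T S"
  then obtain S where S: "adjoint_ops T S" by blast
  then have "(THE S. adjoint_ops T S) = S" using adjoint_ops_unique by blast
  then show "\<exists>R. adjoint_ops (THE S. adjoint_ops T S) R" using adjoint_ops_sym[OF S] by auto
qed

lemma adjoint_ops_Rep_cstar: "adjoint_ops (Rep_multiplier T) (Rep_multiplier (cstar T))"
  by transfer (metis adjoint_ops_unique the_equality)

lemma cstar_multiplier_eqI: "adjoint_ops (Rep_multiplier T) (Rep_multiplier S) \<Longrightarrow> cstar T = S"
  using adjoint_ops_Rep_cstar adjoint_ops_unique Rep_multiplier_inject by metis

instance
proof
  fix x y z :: "'a multiplier" and c d :: complex and r :: real
  show "x * 1 = x" "1 * x = x" by (transfer; simp add: blinfun_eqI)+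
  show "cscaleA c (x + y) = cscaleA c x + cscaleA c y"
    by transfer (simp add: blinfun_eqI blinfun.add_left cscaleA_add_right)
  show "cscaleA (c + d) x = cscaleA c x + cscaleA d x"
    by transfer (simp add: blinfun_eqI blinfun.add_left cscaleA_add_left)
  show "cscaleA c (cscaleA d x) = cscaleA (c * d) x"
    by transfer (simp add: blinfun_eqI cscaleA_cscaleA)
  show "cscaleA (complex_of_real r) x = scaleR r x"
    by transfer (simp add: blinfun_eqI blinfun.scaleR_left cscaleA_of_real)
  show "norm (cscaleA c x) = cmod c * norm x"
    by transfer (simp add: norm_blinfun_cscale)
  show "cscaleA c x * y = cscaleA c (x * y)"
    by transfer (simp add: blinfun_eqI)
  show "x * cscaleA c y = cscaleA c (x * y)"
  proof transfer
    fix c and x y :: "'a \<Rightarrow>\<^sub>L 'a" assume "\<exists>S. adjoint_ops x S"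
    then obtain S where "adjoint_ops x S" by blast
    then have S: "adjoint_ops S x" by (rule adjoint_ops_sym)
    have "blinfun_apply x (cscaleA c v) = cscaleA c (blinfun_apply x v)" for v
    proof -
      have "cstar w * blinfun_apply x (cscaleA c v) = cstar w * cscaleA c (blinfun_apply x v)" for w
        by (simp add: cscaleA_mult_right flip: adjoint_opsD[OF S])
      then have "cstar w * (blinfun_apply x (cscaleA c v) - cscaleA c (blinfun_apply x v)) = 0" for w
        by (simp add: right_diff_distrib)
      then show ?thesis using cstar_mult_self_eq_0 right_minus_eq by blast
    qed
    then show "x o\<^sub>L blinfun_cscale c y = blinfun_cscale c (x o\<^sub>L y)" by (simp add: blinfun_eqI)
  qed
  show "cstar (x + y) = cstar x + cstar y"
    by (rule cstar_multiplier_eqI) (simp add: plus_multiplier.rep_eq adjoint_ops_add adjoint_ops_Rep_cstar)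
  show "cstar (cscaleA c x) = cscaleA (cnj c) (cstar x)"
    by (rule cstar_multiplier_eqI) (simp add: cscaleA_multiplier.rep_eq adjoint_ops_cscale adjoint_ops_Rep_cstar)
  show "cstar (x * y) = cstar y * cstar x"
    by (rule cstar_multiplier_eqI) (simp add: times_multiplier.rep_eq adjoint_ops_compose adjoint_ops_Rep_cstar)
  show "cstar (cstar x) = x"
    by (rule cstar_multiplier_eqI) (simp add: adjoint_ops_sym adjoint_ops_Rep_cstar)
  have "norm (cstar x) = norm x"
    using adjoint_ops_norm_eq[OF adjoint_ops_Rep_cstar[of x]] by (simp add: norm_multiplier.rep_eq)
  then have "norm (cstar x * x) \<le> (norm x)\<^sup>2"
    using norm_mult_ineq[of "cstar x" x] by (simp add: power2_eq_square)
  moreover have "(norm x)\<^sup>2 \<le> norm (cstar x * x)"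
    using adjoint_ops_norm_square_le[OF adjoint_ops_Rep_cstar[of x]]
    by (simp add: norm_multiplier.rep_eq times_multiplier.rep_eq)
  ultimately show "norm (cstar x * x) = (norm x)\<^sup>2" by simp
next
  fix X :: "nat \<Rightarrow> 'a multiplier" assume "Cauchy X"
  then have "Cauchy (\<lambda>n. Rep_multiplier (X n))"
    by (simp add: Cauchy_def dist_multiplier.rep_eq)
  then obtain T where T: "(\<lambda>n. Rep_multiplier (X n)) \<longlonglongrightarrow> T"
    using Cauchy_convergent_iff convergent_def by blast
  obtain S where "adjoint_ops T S"
    using adjoint_ops_limit[OF adjoint_ops_Rep_cstar T] by blast
  then have "Rep_multiplier (Abs_multiplier T) = T" by (intro Abs_multiplier_inverse) blast
  then have "X \<longlonglongrightarrow> Abs_multiplier T"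
    using T by (simp add: lim_sequentially dist_multiplier.rep_eq)
  then show "convergent X" by (rule convergentI)
qed

end

lift_definition left_mult :: "'a::cstar_algebra \<Rightarrow> 'a multiplier" is blinfun_mult_right
proof -
  fix a :: 'a
  have "adjoint_ops (blinfun_mult_right a) (blinfun_mult_right (cstar a))"
    by (simp add: adjoint_ops_def cstar_mult mult.assoc)
  then show "\<exists>S. adjoint_ops (blinfun_mult_right a) S" ..
qed

lemma left_mult_add: "left_mult (a + b) = left_mult a + left_mult b"
  by transfer (simp add: blinfun_eqI blinfun.add_left distrib_right)

lemma left_mult_mult: "left_mult (a * b) = left_mult a * left_mult b"
  by transfer (simp add: blinfun_eqI mult.assoc)

lemma cstar_left_mult: "cstar (left_mult a) = left_mult (cstar a)"
  by (rule cstar_multiplier_eqI)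
    (simp add: left_mult.rep_eq adjoint_ops_def cstar_mult mult.assoc)

lemma norm_left_mult: "norm (left_mult a) = norm a"
proof (transfer, rule antisym)
  fix a :: 'a
  show "norm (blinfun_mult_right a) \<le> norm a"
    by (rule norm_blinfun_bound) (simp_all add: norm_mult_ineq)
  show "norm a \<le> norm (blinfun_mult_right a)"
  proof (cases "a = 0")
    case False
    have "norm a * norm a = norm (blinfun_apply (blinfun_mult_right a) (cstar a))"
      using cstar_identity[of "cstar a"] by (simp add: cstar_cstar power2_eq_square)
    also have "\<dots> \<le> norm (blinfun_mult_right a) * norm a"
      using norm_blinfun[of "blinfun_mult_right a" "cstar a"] by (simp del: blinfun_mult_right.rep_eq)
    finally show ?thesis using False by simp
  qed simp
qed

lemma norm_le_of_positive_identity: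
  fixes a b c d :: "'a::cstar_algebra"
  assumes "norm b \<le> 1"
    and eq: "cstar d * d + cstar a * (cstar b * b) * a = cstar c * c + (cstar a * a + cstar a * a)"
  shows "norm a \<le> norm d"
  using unital_norm_le_of_positive_identity[of "left_mult b" "left_mult d" "left_mult a" "left_mult c"]
    arg_cong[OF eq, of left_mult] assms(1)
  by (simp add: norm_left_mult left_mult_add left_mult_mult cstar_left_mult)

section \<open>Metric and topology of a Hilbert module\<close>

lemma hnorm_nonneg [simp]: "0 \<le> hnorm E x"
  by (simp add: hnorm_def)

context hilbert_module
begin

lemma ip_add_left:
  "\<lbrakk>x \<in> carrier E; y \<in> carrier E; z \<in> carrier E\<rbrakk> \<Longrightarrow> \<langle>x \<oplus> y, z\<rangle> = \<langle>x, z\<rangle> + \<langle>y, z\<rangle>"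
  using ip_cstar[of z "x \<oplus> y"] by (simp add: ip_add_right cstar_add ip_cstar)

lemma ip_zero_right [simp]: "x \<in> carrier E \<Longrightarrow> \<langle>x, \<zero>\<rangle> = 0"
  using ip_add_right[of x \<zero> \<zero>] by simp

lemma ip_zero_left [simp]: "x \<in> carrier E \<Longrightarrow> \<langle>\<zero>, x\<rangle> = 0"
  using ip_cstar[of x \<zero>] by simp

lemma ip_minus_right: "\<lbrakk>x \<in> carrier E; y \<in> carrier E\<rbrakk> \<Longrightarrow> \<langle>x, \<ominus> y\<rangle> = - \<langle>x, y\<rangle>"
  using ip_add_right[of x y "\<ominus> y"] by (simp add: r_neg eq_neg_iff_add_eq_0 add.commute)

lemma ip_minus_left: "\<lbrakk>x \<in> carrier E; y \<in> carrier E\<rbrakk> \<Longrightarrow> \<langle>\<ominus> x, y\<rangle> = - \<langle>x, y\<rangle>"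
  using ip_add_left[of x "\<ominus> x" y] by (simp add: r_neg eq_neg_iff_add_eq_0 add.commute)

lemma ip_diff_right:
  "\<lbrakk>x \<in> carrier E; y \<in> carrier E; z \<in> carrier E\<rbrakk> \<Longrightarrow> \<langle>x, y \<ominus> z\<rangle> = \<langle>x, y\<rangle> - \<langle>x, z\<rangle>"
  by (simp add: minus_eq ip_add_right ip_minus_right)

lemma ip_diff_left:
  "\<lbrakk>x \<in> carrier E; y \<in> carrier E; z \<in> carrier E\<rbrakk> \<Longrightarrow> \<langle>x \<ominus> y, z\<rangle> = \<langle>x, z\<rangle> - \<langle>y, z\<rangle>"
  by (simp add: minus_eq ip_add_left ip_minus_left)

lemma ip_act_left: "\<lbrakk>x \<in> carrier E; y \<in> carrier E\<rbrakk> \<Longrightarrow> \<langle>x \<rhd> a, y\<rangle> = cstar a * \<langle>x, y\<rangle>"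
  using ip_cstar[of y "x \<rhd> a"] by (simp add: ip_act_right act_closed cstar_mult ip_cstar)

lemma ip_cscale_left:
  "\<lbrakk>x \<in> carrier E; y \<in> carrier E\<rbrakk> \<Longrightarrow> \<langle>c \<odot> x, y\<rangle> = cscaleA (cnj c) \<langle>x, y\<rangle>"
  using ip_cstar[of y "c \<odot> x"] by (simp add: ip_cscale_right cscale_closed cstar_cscaleA ip_cstar)

lemma ip_eq_0_sym: "\<lbrakk>x \<in> carrier E; y \<in> carrier E; \<langle>x, y\<rangle> = 0\<rbrakk> \<Longrightarrow> \<langle>y, x\<rangle> = 0"
  using ip_cstar[of x y] by simp

lemma cscale_zero:
  assumes "x \<in> carrier E"
  shows "0 \<odot> x = \<zero>"
  using cscale_add_left[OF assms, of 0 0] cscale_closed[OF assms, of 0]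
  using assms by simp

lemma cscale_minus_one:
  assumes "x \<in> carrier E"
  shows "(-1) \<odot> x = \<ominus> x"
proof -
  have "(-1) \<odot> x \<oplus> x = \<zero>"
    using cscale_add_left[OF assms, of "-1" 1] by (simp add: assms cscale_zero cscale_one)
  then show ?thesis using minus_equality[of "(-1) \<odot> x" x] assms cscale_closed by simp
qed

lemma hnorm_cscale: "x \<in> carrier E \<Longrightarrow> hnorm E (c \<odot> x) = cmod c * hnorm E x"
  by (simp add: hnorm_def ip_cscale_left ip_cscale_right cscale_closed norm_cscaleA real_sqrt_mult)

lemma hnorm_eq_0_iff: "x \<in> carrier E \<Longrightarrow> hnorm E x = 0 \<longleftrightarrow> x = \<zero>"
  using ip_definite by (auto simp: hnorm_def)

text \<open>
  With \<open>a = \<langle>x, y\<rangle>\<close>, expand \<open>\<langle>z, z\<rangle>\<close> for \<open>z = x a - y\<close>. Because \<open>\<langle>x, x\<rangle>\<close>, \<open>\<langle>y, y\<rangle>\<close> and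
  \<open>\<langle>z, z\<rangle>\<close> all have the form \<open>cstar b * b\<close>, the result is an identity between positive elements
  that bounds \<open>norm a\<close>.
\<close>

lemma norm_ip_le_of_hnorm_le_one:
  assumes x: "x \<in> carrier E" and y: "y \<in> carrier E" and le: "hnorm E x \<le> 1"
  shows "norm \<langle>x, y\<rangle> \<le> hnorm E y"
proof -
  define a where "a = \<langle>x, y\<rangle>"
  define z where "z = (x \<rhd> a) \<ominus> y"
  have xa: "x \<rhd> a \<in> carrier E" and z: "z \<in> carrier E" using x y by (auto simp: z_def act_closed)
  obtain b c d where b: "\<langle>x, x\<rangle> = cstar b * b" and c: "\<langle>z, z\<rangle> = cstar c * c"
    and d: "\<langle>y, y\<rangle> = cstar d * d"
    using ip_nonneg[OF x] ip_nonneg[OF y] ip_nonneg[OF z] unfolding cstar_nonneg_def by blast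
  have yx: "\<langle>y, x\<rangle> = cstar a" using ip_cstar[OF x y] by (simp add: a_def)
  have "\<langle>z, z\<rangle> = cstar a * \<langle>x, x\<rangle> * a - cstar a * a - (cstar a * a - \<langle>y, y\<rangle>)"
    unfolding z_def using x y xa
    by (simp add: ip_diff_left ip_diff_right ip_act_left ip_act_right yx flip: a_def)
      (simp add: algebra_simps)
  then have "cstar d * d + cstar a * (cstar b * b) * a = cstar c * c + (cstar a * a + cstar a * a)"
    by (simp add: b c d)
  moreover have "norm b \<le> 1"
    using le by (simp add: hnorm_def b cstar_identity)
  ultimately have "norm a \<le> norm d" by (rule norm_le_of_positive_identity[rotated])
  then show ?thesis by (simp add: hnorm_def d cstar_identity a_def)
qed

theorem Cauchy_Schwarz:
  assumes x: "x \<in> carrier E" and y: "y \<in> carrier E"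
  shows "norm \<langle>x, y\<rangle> \<le> hnorm E x * hnorm E y"
proof (cases "x = \<zero>")
  case False
  then have pos: "0 < hnorm E x" using hnorm_eq_0_iff[OF x] hnorm_nonneg[of E x] by linarith
  define c where "c = complex_of_real (1 / hnorm E x)"
  have c: "cmod c = 1 / hnorm E x" using pos by (simp add: c_def del: of_real_divide)
  have "norm \<langle>c \<odot> x, y\<rangle> \<le> hnorm E y"
    using pos x y by (intro norm_ip_le_of_hnorm_le_one) (simp_all add: hnorm_cscale cscale_closed c)
  then show ?thesis
    using pos x y by (simp add: ip_cscale_left norm_cscaleA c divide_simps mult.commute)
qed (use y in simp)

lemma hnorm_add_le:
  assumes x: "x \<in> carrier E" and y: "y \<in> carrier E"
  shows "hnorm E (x \<oplus> y) \<le> hnorm E x + hnorm E y"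
proof (rule power2_le_imp_le)
  have sq: "(hnorm E u)\<^sup>2 = norm \<langle>u, u\<rangle>" for u by (simp add: hnorm_def)
  have "\<langle>x \<oplus> y, x \<oplus> y\<rangle> = (\<langle>x, x\<rangle> + \<langle>x, y\<rangle>) + (\<langle>y, x\<rangle> + \<langle>y, y\<rangle>)"
    using x y by (simp add: ip_add_left ip_add_right)
  then have "norm \<langle>x \<oplus> y, x \<oplus> y\<rangle> \<le> norm \<langle>x, x\<rangle> + norm \<langle>x, y\<rangle> + (norm \<langle>y, x\<rangle> + norm \<langle>y, y\<rangle>)"
    by (simp only:) (intro norm_triangle_mono norm_triangle_ineq)
  also have "\<dots> \<le> (hnorm E x)\<^sup>2 + hnorm E x * hnorm E y + (hnorm E y * hnorm E x + (hnorm E y)\<^sup>2)"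
    using Cauchy_Schwarz x y by (intro add_mono) (simp_all add: sq)
  also have "\<dots> = (hnorm E x + hnorm E y)\<^sup>2" by (simp add: power2_eq_square algebra_simps)
  finally show "(hnorm E (x \<oplus> y))\<^sup>2 \<le> (hnorm E x + hnorm E y)\<^sup>2" by (simp add: sq)
qed simp

lemma hnorm_minus: "x \<in> carrier E \<Longrightarrow> hnorm E (\<ominus> x) = hnorm E x"
  by (simp add: hnorm_def ip_minus_left ip_minus_right)

lemma hnorm_diff_commute:
  assumes "x \<in> carrier E" "y \<in> carrier E"
  shows "hnorm E (x \<ominus> y) = hnorm E (y \<ominus> x)"
proof -
  have "y \<ominus> x = \<ominus> (x \<ominus> y)" using assms by (simp add: minus_eq minus_add a_comm)
  then show ?thesis using hnorm_minus[of "x \<ominus> y"] assms by simp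
qed

lemma diff_eq_zero_iff: "\<lbrakk>x \<in> carrier E; y \<in> carrier E\<rbrakk> \<Longrightarrow> x \<ominus> y = \<zero> \<longleftrightarrow> x = y"
  using minus_equality[of x "\<ominus> y"] by (auto simp: minus_eq r_neg)

sublocale metric: Metric_space "carrier E" "hdist E"
proof
  fix x y z
  show "0 \<le> hdist E x y" by (simp add: hdist_def)
  show "hdist E x y = hdist E y x" by (simp add: hdist_def hnorm_diff_commute)
  assume x: "x \<in> carrier E" and y: "y \<in> carrier E"
  show "hdist E x y = 0 \<longleftrightarrow> x = y"
    using x y by (simp add: hdist_def hnorm_eq_0_iff diff_eq_zero_iff)
  assume z: "z \<in> carrier E"
  have "x \<ominus> z = (x \<ominus> y) \<oplus> (y \<ominus> z)"
    using x y z by (simp add: minus_eq a_assoc r_neg1)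
  then show "hdist E x z \<le> hdist E x y + hdist E y z"
    using x y z hnorm_add_le by (simp add: hdist_def)
qed

text \<open>
  By the Cauchy-Schwarz inequality \<open>\<langle>x, y\<rangle>\<close> is Lipschitz in \<open>x\<close> with constant \<open>hnorm E y\<close>, so it
  stays nonzero in a ball around a point where it is nonzero.
\<close>

lemma closedin_orth_compl:
  assumes N: "N \<subseteq> carrier E"
  shows "closedin (htop E) (orth_compl E N)"
  unfolding metric.closedin_metric
proof (intro conjI allI impI)
  show "orth_compl E N \<subseteq> carrier E" by (auto simp: orth_compl_def)
  fix x assume "x \<in> carrier E - orth_compl E N"
  then obtain y where x: "x \<in> carrier E" and y: "y \<in> N" "\<langle>x, y\<rangle> \<noteq> 0"
    by (auto simp: orth_compl_def)
  have yc: "y \<in> carrier E" using y N by auto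
  \<comment> \<open>The summand 1 keeps the denominator positive and makes the estimate below strict.\<close>
  define r where "r = norm \<langle>x, y\<rangle> / (hnorm E y + 1)"
  have hy: "0 < hnorm E y + 1" by (simp add: add_nonneg_pos)
  then have "0 < r" using y by (simp add: r_def)
  moreover have "\<langle>x', y\<rangle> \<noteq> 0" if "x' \<in> metric.mball x r" for x'
  proof
    assume 0: "\<langle>x', y\<rangle> = 0"
    have x': "x' \<in> carrier E" "hnorm E (x \<ominus> x') < r"
      using that x by (auto simp: metric.mball_def hdist_def)
    have "norm \<langle>x, y\<rangle> = norm \<langle>x \<ominus> x', y\<rangle>" using x x' yc by (simp add: ip_diff_left 0)
    also have "\<dots> \<le> hnorm E (x \<ominus> x') * hnorm E y" using x x' yc by (intro Cauchy_Schwarz) auto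
    also have "\<dots> \<le> r * hnorm E y" using x' by (intro mult_right_mono) auto
    also have "\<dots> < r * (hnorm E y + 1)" using \<open>0 < r\<close> by (intro mult_strict_left_mono) auto
    also have "\<dots> = norm \<langle>x, y\<rangle>" using hy by (simp add: r_def)
    finally show False by simp
  qed
  ultimately show "\<exists>r>0. disjnt (orth_compl E N) (metric.mball x r)"
    using y by (intro exI[of _ r]) (auto simp: disjnt_iff orth_compl_def)
qed

lemma submodule_orth_compl:
  assumes "N \<subseteq> carrier E"
  shows "submodule E (orth_compl E N)"
  using assms by (auto simp: submodule_def orth_compl_def ip_add_left ip_cscale_left ip_act_left
      cscale_closed act_closed subset_iff)

lemma orthogonal_to_dense_eq_zero:
  assumes D: "dense_in E D" and w: "w \<in> carrier E" and orth: "\<And>x. x \<in> D \<Longrightarrow> \<langle>x, w\<rangle> = 0"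
  shows "w = \<zero>"
proof -
  have "D \<subseteq> orth_compl E {w}" using D orth by (auto simp: dense_in_def orth_compl_def)
  moreover have "closedin (htop E) (orth_compl E {w})"
    by (rule closedin_orth_compl) (use w in simp)
  ultimately have "w \<in> orth_compl E {w}"
    using closure_of_minimal D w unfolding dense_in_def by blast
  then show ?thesis using w by (simp add: orth_compl_def ip_definite)
qed

lemma orth_compl_inter:
  assumes "N \<subseteq> carrier E" "x \<in> N" "x \<in> orth_compl E N"
  shows "x = \<zero>"
  using assms by (auto simp: orth_compl_def intro: ip_definite)

lemma submodule_a_inv_closed:
  assumes "submodule E D" "x \<in> D"
  shows "\<ominus> x \<in> D"
proof -
  have "x \<in> carrier E" "(-1) \<odot> x \<in> D" using assms by (auto simp: submodule_def)
  then show ?thesis by (simp add: cscale_minus_one)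
qed

lemma submodule_subgroup:
  assumes "submodule E D"
  shows "subgroup D (add_monoid E)"
  using assms submodule_a_inv_closed[OF assms]
  by (intro add.subgroupI) (auto simp: submodule_def)

end

section \<open>Submodules and isomorphic copies of Hilbert modules\<close>

text \<open>
  The last assumption is what \<open>hdist\<close> satisfies by its convention off the carrier. Two instances
  are used: \<open>V\<close> the identity, since \<open>hdist\<close> of a submodule and of the whole module agree only on
  the submodule, and \<open>V\<close> an isomorphism.
\<close>

lemma mcomplete_isometric_image:
  assumes M: "Metric_space M d" and complete: "Metric_space.mcomplete M d"
    and img: "V ` M = N" and iso: "\<And>x y. x \<in> M \<Longrightarrow> y \<in> M \<Longrightarrow> d' (V x) (V y) = d x y"
    and off: "\<And>x y. x \<notin> N \<or> y \<notin> N \<Longrightarrow> d' x y = 0"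
  shows "Metric_space.mcomplete N d'"
proof -
  interpret M: Metric_space M d by fact
  have N: "x \<in> N \<longleftrightarrow> (\<exists>u\<in>M. x = V u)" for x using img by auto
  interpret N: Metric_space N d'
  proof
    fix x y z
    show "0 \<le> d' x y" using off[of x y] N iso by (cases "x \<in> N \<and> y \<in> N") (auto simp: N)
    show "d' x y = d' y x"
      using off[of x y] off[of y x] by (cases "x \<in> N \<and> y \<in> N") (auto simp: N iso M.commute)
    assume x: "x \<in> N" and y: "y \<in> N"
    then show "d' x y = 0 \<longleftrightarrow> x = y" by (smt (verit) N iso M.zero)
    assume "z \<in> N"
    then show "d' x z \<le> d' x y + d' y z" using x y by (auto simp: N iso M.triangle)
  qed
  show ?thesis unfolding N.mcomplete_def
  proof (intro allI impI)
    fix s assume s: "N.MCauchy s"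
    then have "\<forall>n. \<exists>u\<in>M. s n = V u" using N unfolding N.MCauchy_def by blast
    then obtain u where u: "\<And>n. u n \<in> M" "\<And>n. s n = V (u n)" by metis
    have "M.MCauchy u" using s u by (auto simp: N.MCauchy_def M.MCauchy_def iso)
    then obtain l where "limitin M.mtopology u l sequentially"
      using complete by (auto simp: M.mcomplete_def)
    then have "limitin N.mtopology s (V l) sequentially"
      using u by (simp add: N.limit_metric_sequentially M.limit_metric_sequentially iso N) blast
    then show "\<exists>x. limitin N.mtopology s x sequentially" ..
  qed
qed

lemma (in hilbert_module) closed_submodule_hilbert_module:
  assumes D: "submodule E D" and closed: "closedin (htop E) D"
  shows "hilbert_module (E\<lparr>carrier := D\<rparr>)"
proof -
  let ?F = "E\<lparr>carrier := D\<rparr>"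
  have sub: "D \<subseteq> carrier E" using D by (simp add: submodule_def)
  have F: "abelian_group ?F"
  proof (rule abelian_groupI)
    fix x assume "x \<in> carrier ?F"
    then show "\<exists>y\<in>carrier ?F. y \<oplus>\<^bsub>?F\<^esub> x = \<zero>\<^bsub>?F\<^esub>"
      using submodule_a_inv_closed[OF D] sub by (auto intro!: bexI[of _ "\<ominus> x"] l_neg)
  qed (use D sub in \<open>auto simp: submodule_def a_ac subset_iff\<close>)
  have inv: "\<ominus>\<^bsub>?F\<^esub> x = \<ominus> x" if "x \<in> D" for x
    using that sub submodule_a_inv_closed[OF D that]
    by (intro abelian_group.minus_equality[OF F]) (auto intro!: l_neg)
  have diff: "x \<ominus>\<^bsub>?F\<^esub> y = x \<ominus> y" if "x \<in> D" "y \<in> D" for x y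
    using that inv by (simp add: a_minus_def)
  interpret sub: Submetric "carrier E" "hdist E" D
    by unfold_locales (rule sub)
  have "Metric_space.mcomplete D (hdist E)"
    using closed complete by (rule sub.closedin_mcomplete_imp_mcomplete)
  then have complete_F: "Metric_space.mcomplete D (hdist ?F)"
    by (rule mcomplete_isometric_image[where V = "\<lambda>x. x", OF sub.sub.Metric_space_axioms])
      (use sub diff in \<open>auto simp: hdist_def hnorm_def subset_iff\<close>)
  show ?thesis
  proof (intro hilbert_module.intro hilbert_module_axioms.intro)
    show "Metric_space.mcomplete (carrier ?F) (hdist ?F)" using complete_F by simp
  qed (use F D sub in \<open>auto simp: submodule_def subset_iff cscale_add_right cscale_add_left cscale_cscale
      cscale_one act_add_left act_add_right act_act cscale_act act_cscaleA ip_add_right ip_cscale_right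
      ip_act_right ip_cstar ip_nonneg ip_definite\<close>)
qed

text \<open>
  This spares a direct verification of the axioms, completeness above all, for the quotient module.
\<close>

lemma hilbert_module_isometric_image:
  fixes H :: "('a::cstar_algebra, 'e) hmodule" and Q :: "('a, 'f) hmodule"
  assumes H: "hilbert_module H"
    and lin: "linear_map_on H Q (carrier H) V"
    and bij: "bij_betw V (carrier H) (carrier Q)"
    and zero: "V \<zero>\<^bsub>H\<^esub> = \<zero>\<^bsub>Q\<^esub>"
    and ip: "\<And>x y. x \<in> carrier H \<Longrightarrow> y \<in> carrier H \<Longrightarrow> \<langle>V x, V y\<rangle>\<^bsub>Q\<^esub> = \<langle>x, y\<rangle>\<^bsub>H\<^esub>"
  shows "hilbert_module Q"
proof -
  interpret H: hilbert_module H by fact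
  have Q: "carrier Q = V ` carrier H" using bij by (simp add: bij_betw_def)
  have add: "x \<in> carrier H \<Longrightarrow> y \<in> carrier H \<Longrightarrow> V x \<oplus>\<^bsub>Q\<^esub> V y = V (x \<oplus>\<^bsub>H\<^esub> y)"
    and scale: "x \<in> carrier H \<Longrightarrow> c \<odot>\<^bsub>Q\<^esub> V x = V (c \<odot>\<^bsub>H\<^esub> x)"
    and act: "x \<in> carrier H \<Longrightarrow> V x \<rhd>\<^bsub>Q\<^esub> a = V (x \<rhd>\<^bsub>H\<^esub> a)" for x y c a
    using lin by (auto simp: linear_map_on_def)
  note ops = zero[symmetric] add scale act ip
  have G: "abelian_group Q"
  proof (rule abelian_groupI)
    fix X assume "X \<in> carrier Q"
    then obtain x where x: "x \<in> carrier H" "X = V x" by (auto simp: Q)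
    show "\<exists>Y\<in>carrier Q. Y \<oplus>\<^bsub>Q\<^esub> X = \<zero>\<^bsub>Q\<^esub>"
      using x by (intro bexI[of _ "V (\<ominus>\<^bsub>H\<^esub> x)"]) (auto simp: ops Q H.l_neg)
  qed (auto simp: Q ops H.a_ac)
  interpret G: abelian_group Q by fact
  have diff: "V x \<ominus>\<^bsub>Q\<^esub> V y = V (x \<ominus>\<^bsub>H\<^esub> y)" if "x \<in> carrier H" "y \<in> carrier H" for x y
  proof -
    have "\<ominus>\<^bsub>Q\<^esub> V y = V (\<ominus>\<^bsub>H\<^esub> y)"
      using that by (intro G.minus_equality) (auto simp: ops Q H.l_neg)
    then show ?thesis using that by (simp add: a_minus_def ops)
  qed
  have "Metric_space.mcomplete (carrier Q) (hdist Q)"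
    by (rule mcomplete_isometric_image[where V = V, OF H.metric.Metric_space_axioms H.complete])
      (auto simp: Q hdist_def hnorm_def diff ip)
  with G show ?thesis
  proof (intro hilbert_module.intro hilbert_module_axioms.intro)
    fix X assume "X \<in> carrier Q" "\<langle>X, X\<rangle>\<^bsub>Q\<^esub> = 0"
    then show "X = \<zero>\<^bsub>Q\<^esub>" using H.ip_definite by (auto simp: Q ops)
  qed (auto simp: Q ops H.cscale_closed H.act_closed H.cscale_add_right H.cscale_add_left H.cscale_cscale
      H.cscale_one H.act_add_left H.act_add_right H.act_act H.cscale_act H.act_cscaleA H.ip_add_right
      H.ip_cscale_right H.ip_act_right H.ip_cstar H.ip_nonneg)
qed

lemma is_hmodule_iso_sym:
  assumes "E \<cong>\<^sub>H F"
  shows "F \<cong>\<^sub>H E"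
proof -
  from assms obtain V where E: "hilbert_module E" and F: "hilbert_module F"
    and V: "V \<in> hmodule_iso E F"
    by (auto simp: is_hmodule_iso_def)
  interpret E: hilbert_module E by fact
  from V have lin: "linear_map_on E F (carrier E) V" and bij: "bij_betw V (carrier E) (carrier F)"
    and ip: "\<And>x y. x \<in> carrier E \<Longrightarrow> y \<in> carrier E \<Longrightarrow> \<langle>V x, V y\<rangle>\<^bsub>F\<^esub> = \<langle>x, y\<rangle>\<^bsub>E\<^esub>"
    by (auto simp: hmodule_iso_def)
  define W where "W = inv_into (carrier E) V"
  have W: "W (V x) = x" if "x \<in> carrier E" for x
    using bij that by (simp add: W_def bij_betw_inv_into_left)
  have Q: "carrier F = V ` carrier E" using bij by (simp add: bij_betw_def)
  have add: "x \<in> carrier E \<Longrightarrow> y \<in> carrier E \<Longrightarrow> V x \<oplus>\<^bsub>F\<^esub> V y = V (x \<oplus>\<^bsub>E\<^esub> y)"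
    and scale: "x \<in> carrier E \<Longrightarrow> c \<odot>\<^bsub>F\<^esub> V x = V (c \<odot>\<^bsub>E\<^esub> x)"
    and act: "x \<in> carrier E \<Longrightarrow> V x \<rhd>\<^bsub>F\<^esub> a = V (x \<rhd>\<^bsub>E\<^esub> a)" for x y c a
    using lin by (auto simp: linear_map_on_def)
  have "W \<in> hmodule_iso F E"
    using bij_betw_inv_into[OF bij]
    by (auto simp: hmodule_iso_def linear_map_on_def Q add scale act ip W E.cscale_closed E.act_closed
        simp flip: W_def)
  then show ?thesis using E F by (auto simp: is_hmodule_iso_def)
qed

section \<open>The quotient by an orthogonally complemented submodule\<close>

context hilbert_module
begin

lemma orth_complementedE:
  assumes "orth_complemented E N" "x \<in> carrier E"
  obtains n h where "n \<in> N" "h \<in> orth_compl E N" "x = n \<oplus> h"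
  using assms unfolding orth_complemented_def set_add_def' by blast

lemma orth_compl_orth_compl:
  assumes N: "orth_complemented E N"
  shows "orth_compl E (orth_compl E N) = N"
proof
  have sub: "N \<subseteq> carrier E" using N by (auto simp: orth_complemented_def submodule_def)
  then show "N \<subseteq> orth_compl E (orth_compl E N)"
    by (auto simp: orth_compl_def intro: ip_eq_0_sym)
  show "orth_compl E (orth_compl E N) \<subseteq> N"
  proof
    fix x assume x: "x \<in> orth_compl E (orth_compl E N)"
    then have "x \<in> carrier E" by (simp add: orth_compl_def)
    with N obtain n h where nh: "n \<in> N" "h \<in> orth_compl E N" "x = n \<oplus> h"
      by (rule orth_complementedE)
    have c: "n \<in> carrier E" "h \<in> carrier E" using nh sub by (auto simp: orth_compl_def)
    have "\<langle>x, h\<rangle> = 0" using x nh by (simp add: orth_compl_def)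
    moreover have "\<langle>n, h\<rangle> = 0" using nh c by (auto simp: orth_compl_def intro: ip_eq_0_sym)
    ultimately have "\<langle>h, h\<rangle> = 0" using c by (simp add: nh(3) ip_add_left)
    then have "h = \<zero>" using c by (simp add: ip_definite)
    then show "x \<in> N" using nh c by simp
  qed
qed

text \<open>
  The projection is constant on each coset of \<open>N\<close>, and its value is the element of the coset that
  is orthogonal to \<open>N\<close>. Uniqueness holds because two candidates differ by an element of both
  \<open>N\<close> and its complement.
\<close>

lemma orth_proj_coset:
  assumes N: "orth_complemented E N" and n: "n \<in> N" and h: "h \<in> orth_compl E N"
  shows "orth_proj E (orth_compl E N) (n \<oplus> h) = h"
  unfolding orth_proj_def
proof (rule the_equality)
  have sub: "N \<subseteq> carrier E" using N by (auto simp: orth_complemented_def submodule_def)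
  have c: "n \<in> carrier E" "h \<in> carrier E" using n h sub by (auto simp: orth_compl_def)
  have "n \<oplus> h \<ominus> h = n" using c by (simp add: minus_eq a_assoc r_neg)
  then show "h \<in> orth_compl E N \<and> n \<oplus> h \<ominus> h \<in> orth_compl E (orth_compl E N)"
    using n h N by (simp add: orth_compl_orth_compl)
  fix y assume y: "y \<in> orth_compl E N \<and> n \<oplus> h \<ominus> y \<in> orth_compl E (orth_compl E N)"
  then have yc: "y \<in> carrier E" by (simp add: orth_compl_def)
  have sN: "submodule E N" and sH: "submodule E (orth_compl E N)"
    using N sub by (auto simp: orth_complemented_def submodule_orth_compl)
  have "\<ominus> n \<oplus> (n \<oplus> h \<ominus> y) \<in> N"
    using sN y N n submodule_a_inv_closed[OF sN] by (auto simp: orth_compl_orth_compl submodule_def)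
  moreover have "\<ominus> n \<oplus> (n \<oplus> h \<ominus> y) = h \<ominus> y"
    using c yc by (simp add: minus_eq a_assoc r_neg1)
  moreover have "h \<ominus> y \<in> orth_compl E N"
    using sH y h submodule_a_inv_closed[OF sH] by (auto simp: minus_eq submodule_def)
  ultimately have "h \<ominus> y = \<zero>" using orth_compl_inter sub by auto
  then show "y = h" using c yc by (simp add: diff_eq_zero_iff)
qed

text \<open>
  Every coset of \<open>N\<close> contains exactly one element \<open>h\<close> orthogonal to \<open>N\<close>, so \<open>h \<mapsto> N + h\<close> is a
  bijection from the complement. It intertwines the operations, and the inner product of the
  quotient is defined so as to be preserved. The quotient is thereby shown to be a Hilbert module.
\<close>

theorem quotient_hmodule_iso_orth_compl:
  assumes N: "orth_complemented E N"
  shows "quotient_hmodule E N \<cong>\<^sub>H E\<lparr>carrier := orth_compl E N\<rparr>"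
proof (rule is_hmodule_iso_sym)
  let ?H = "E\<lparr>carrier := orth_compl E N\<rparr>" and ?Q = "quotient_hmodule E N"
  define V where "V = (\<lambda>h. N +> h)"
  define p where "p = orth_proj E (orth_compl E N)"
  have sN: "submodule E N" using N by (simp add: orth_complemented_def)
  then have sub: "N \<subseteq> carrier E" by (simp add: submodule_def)
  have sH: "submodule E (orth_compl E N)" using sub by (rule submodule_orth_compl)
  have Hc: "h \<in> carrier E" if "h \<in> orth_compl E N" for h using that by (simp add: orth_compl_def)
  have H: "hilbert_module ?H"
    by (intro closed_submodule_hilbert_module sH closedin_orth_compl sub)
  interpret N: abelian_subgroup N E
    by (intro abelian_subgroupI3 additive_subgroupI submodule_subgroup sN abelian_group_axioms)
  have coset: "X \<in> N +> h \<longleftrightarrow> (\<exists>n\<in>N. X = n \<oplus> h)" for X h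
    by (auto simp: a_r_coset_def')
  have coset_eq: "N +> (n \<oplus> h) = N +> h" if "n \<in> N" "h \<in> carrier E" for n h
    using that a_repr_independence[of "n \<oplus> h" N h] N.a_subgroup by (auto simp: coset)
  have carrier_Q: "carrier ?Q = V ` orth_compl E N"
  proof -
    have "N +> x \<in> V ` orth_compl E N" if x: "x \<in> carrier E" for x
    proof -
      obtain n h where "n \<in> N" "h \<in> orth_compl E N" "x = n \<oplus> h"
        by (rule orth_complementedE[OF N x])
      then show ?thesis using coset_eq Hc by (auto simp: V_def)
    qed
    then show ?thesis using Hc
      by (auto simp: quotient_hmodule_def Let_def A_RCOSETS_def' V_def)
  qed
  \<comment> \<open>The unions that define scalar multiplication and action on cosets are unions of equal sets.\<close>
  have union: "(\<Union>x\<in>N +> h. N +> f x) = N +> f h"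
    if h: "h \<in> carrier E" and f: "\<And>n. n \<in> N \<Longrightarrow> \<exists>m\<in>N. f (n \<oplus> h) = m \<oplus> f h" "f h \<in> carrier E" for f h
  proof -
    have "N +> f x = N +> f h" if "x \<in> N +> h" for x
    proof -
      obtain n where "n \<in> N" "x = n \<oplus> h" using \<open>x \<in> N +> h\<close> by (auto simp: coset)
      then obtain m where "m \<in> N" "f x = m \<oplus> f h" using f(1) by blast
      then show ?thesis using coset_eq f(2) by simp
    qed
    moreover have "h \<in> N +> h" using h N.a_rcos_self by simp
    ultimately show ?thesis by blast
  qed
  have add: "V (x \<oplus> y) = V x \<oplus>\<^bsub>?Q\<^esub> V y" if "x \<in> orth_compl E N" "y \<in> orth_compl E N" for x y
    using that Hc by (simp add: quotient_hmodule_def Let_def V_def N.a_rcos_sum)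
  have scale: "V (c \<odot> x) = c \<odot>\<^bsub>?Q\<^esub> V x" if "x \<in> orth_compl E N" for c x
  proof -
    have "\<exists>m\<in>N. c \<odot> (n \<oplus> x) = m \<oplus> (c \<odot> x)" if "n \<in> N" for n
      using that sN sub Hc[OF \<open>x \<in> _\<close>] by (auto simp: submodule_def subset_iff cscale_add_right)
    then show ?thesis using union[of x "\<lambda>x. c \<odot> x"] Hc[OF that]
      by (simp add: quotient_hmodule_def Let_def V_def cscale_closed)
  qed
  have act: "V (x \<rhd> a) = V x \<rhd>\<^bsub>?Q\<^esub> a" if "x \<in> orth_compl E N" for a x
  proof -
    have "\<exists>m\<in>N. (n \<oplus> x) \<rhd> a = m \<oplus> (x \<rhd> a)" if "n \<in> N" for n
      using that sN sub Hc[OF \<open>x \<in> _\<close>] by (auto simp: submodule_def subset_iff act_add_left)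
    then show ?thesis using union[of x "\<lambda>x. x \<rhd> a"] Hc[OF that]
      by (simp add: quotient_hmodule_def Let_def V_def act_closed)
  qed
  have p: "p u = h" if "u \<in> V h" "h \<in> orth_compl E N" for u h
    using that orth_proj_coset[OF N] by (auto simp: V_def coset p_def)
  have mem: "h \<in> V h" if "h \<in> orth_compl E N" for h
    using that Hc N.a_rcos_self by (simp add: V_def)
  have ip: "\<langle>V x, V y\<rangle>\<^bsub>?Q\<^esub> = \<langle>x, y\<rangle>" if "x \<in> orth_compl E N" "y \<in> orth_compl E N" for x y
  proof -
    have "\<langle>V x, V y\<rangle>\<^bsub>?Q\<^esub> = (THE a. \<forall>u\<in>V x. \<forall>v\<in>V y. a = \<langle>p u, p v\<rangle>)"
      by (simp add: quotient_hmodule_def Let_def p_def)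
    also have "\<dots> = \<langle>x, y\<rangle>"
      using that mem[OF that(1)] mem[OF that(2)] by (intro the_equality) (auto simp: p)
    finally show ?thesis .
  qed
  have zero: "V \<zero> = \<zero>\<^bsub>?Q\<^esub>"
    using sub by (simp add: quotient_hmodule_def Let_def V_def)
  have bij: "bij_betw V (carrier ?H) (carrier ?Q)"
    unfolding bij_betw_def by (auto simp: carrier_Q inj_on_def) (metis mem p)
  have lin: "linear_map_on ?H ?Q (carrier ?H) V"
    by (auto simp: linear_map_on_def add scale act carrier_Q)
  have "hilbert_module ?Q"
    by (rule hilbert_module_isometric_image[OF H lin bij]) (simp_all add: zero ip)
  moreover have "V \<in> hmodule_iso ?H ?Q" using lin bij by (simp add: hmodule_iso_def ip)
  ultimately show "?H \<cong>\<^sub>H ?Q" using H by (auto simp: is_hmodule_iso_def)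
qed

end

section \<open>Adjoints, kernels and the Hodge decomposition\<close>

lemma (in abelian_group) set_add_commute:
  assumes "A \<subseteq> carrier G" "B \<subseteq> carrier G"
  shows "A <+>\<^bsub>G\<^esub> B = B <+>\<^bsub>G\<^esub> A"
proof -
  have *: "A <+>\<^bsub>G\<^esub> B \<subseteq> B <+>\<^bsub>G\<^esub> A" if "A \<subseteq> carrier G" "B \<subseteq> carrier G" for A B
    using that a_comm unfolding set_add_def' by blast
  show ?thesis using *[of A B] *[of B A] assms by blast
qed

lemma (in abelian_group) set_add_right_commute:
  assumes "A \<subseteq> carrier G" "B \<subseteq> carrier G" "C \<subseteq> carrier G"
  shows "(A <+>\<^bsub>G\<^esub> B) <+>\<^bsub>G\<^esub> C = (A <+>\<^bsub>G\<^esub> C) <+>\<^bsub>G\<^esub> B"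
proof -
  have *: "(A <+>\<^bsub>G\<^esub> B) <+>\<^bsub>G\<^esub> C \<subseteq> (A <+>\<^bsub>G\<^esub> C) <+>\<^bsub>G\<^esub> B"
    if sub: "A \<subseteq> carrier G" "B \<subseteq> carrier G" "C \<subseteq> carrier G" for A B C
  proof
    fix x assume "x \<in> (A <+>\<^bsub>G\<^esub> B) <+>\<^bsub>G\<^esub> C"
    then obtain a b c where abc: "a \<in> A" "b \<in> B" "c \<in> C" "x = a \<oplus> b \<oplus> c"
      unfolding set_add_def' by blast
    then have "x = a \<oplus> c \<oplus> b" using sub by (simp add: a_ac subset_iff)
    then show "x \<in> (A <+>\<^bsub>G\<^esub> C) <+>\<^bsub>G\<^esub> B" using abc unfolding set_add_def' by blast
  qed
  show ?thesis using *[of A B C] *[of A C B] assms by blast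
qed

text \<open>
  The adjoint is a definite description; it has the defining property because the difference of two
  candidates is orthogonal to the dense domain of \<open>t\<close>.
\<close>

lemma adj_SomeD:
  assumes E: "hilbert_module E" and t: "semi_regular E F t" and y: "adj E F t y = Some z"
  shows "adjoint_pair E F t y z"
proof -
  interpret E: hilbert_module E by fact
  have dense: "dense_in E (dom t)" using t by (simp add: semi_regular_def)
  then have dom: "dom t \<subseteq> carrier E" by (simp add: dense_in_def)
  from y obtain z' where z': "adjoint_pair E F t y z'" and z: "z = (THE z. adjoint_pair E F t y z)"
    by (auto simp: adj_def split: if_splits)
  have "u = z'" if u: "adjoint_pair E F t y u" for u
  proof -
    have c: "u \<in> carrier E" "z' \<in> carrier E" using u z' by (auto simp: adjoint_pair_def)
    have "\<langle>x, u \<ominus>\<^bsub>E\<^esub> z'\<rangle>\<^bsub>E\<^esub> = 0" if "x \<in> dom t" for x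
    proof -
      have "\<langle>x, u\<rangle>\<^bsub>E\<^esub> = \<langle>x, z'\<rangle>\<^bsub>E\<^esub>"
        using u z' that unfolding adjoint_pair_def by metis
      then show ?thesis using c dom that by (simp add: E.ip_diff_right subset_iff)
    qed
    then have "u \<ominus>\<^bsub>E\<^esub> z' = \<zero>\<^bsub>E\<^esub>" using c by (intro E.orthogonal_to_dense_eq_zero[OF dense]) auto
    then show ?thesis using c by (simp add: E.diff_eq_zero_iff)
  qed
  with z' have "(THE z. adjoint_pair E F t y z) = z'" by blast
  then show ?thesis using z z' by simp
qed

lemma ker_orthogonal_ran_adj:
  assumes E: "hilbert_module E" and F: "hilbert_module F" and t: "semi_regular E F t"
    and x: "x \<in> ker F t" and a: "a \<in> ran (adj E F t)"
  shows "\<langle>x, a\<rangle>\<^bsub>E\<^esub> = 0"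
proof -
  interpret F: hilbert_module F by fact
  from a obtain y where "adj E F t y = Some a" by (auto simp: ran_def)
  then have "adjoint_pair E F t y a" by (rule adj_SomeD[OF E t])
  moreover have "t x = Some \<zero>\<^bsub>F\<^esub>" using x by (simp add: ker_def)
  ultimately have "\<langle>\<zero>\<^bsub>F\<^esub>, y\<rangle>\<^bsub>F\<^esub> = \<langle>x, a\<rangle>\<^bsub>E\<^esub>" "y \<in> carrier F"
    unfolding adjoint_pair_def by (metis domI option.sel)+
  then show ?thesis by simp
qed

text \<open>
  If \<open>x = b + a\<close> is orthogonal to \<open>A\<close> then \<open>\<langle>a, a\<rangle> = \<langle>x, a\<rangle> = 0\<close>. As orthogonal complements are
  closed submodules, this makes the summands of the Hodge decomposition closed.
\<close>

lemma (in hilbert_module) orth_compl_of_orthogonal_summand: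
  assumes sub: "B \<subseteq> carrier E" "A \<subseteq> carrier E"
    and sum: "carrier E = B <+>\<^bsub>E\<^esub> A" and orth: "\<And>x y. x \<in> B \<Longrightarrow> y \<in> A \<Longrightarrow> \<langle>x, y\<rangle> = 0"
  shows "orth_compl E A = B"
proof
  show "B \<subseteq> orth_compl E A" using sub orth by (auto simp: orth_compl_def)
  show "orth_compl E A \<subseteq> B"
  proof
    fix x assume x: "x \<in> orth_compl E A"
    then obtain b a where ba: "b \<in> B" "a \<in> A" "x = b \<oplus> a"
      using sum unfolding orth_compl_def set_add_def' by blast
    then have "\<langle>x, a\<rangle> = 0" using x by (simp add: orth_compl_def)
    then have "\<langle>a, a\<rangle> = 0" using ba sub orth by (simp add: ip_add_left subset_iff)
    then have "a = \<zero>" using ba sub by (auto intro: ip_definite)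
    then show "x \<in> B" using ba sub by (auto simp: subset_iff)
  qed
qed

lemma ker_add_closed:
  assumes F: "hilbert_module F" and t: "semi_regular E F t" and xy: "x \<in> ker F t" "y \<in> ker F t"
  shows "x \<oplus>\<^bsub>E\<^esub> y \<in> ker F t"
proof -
  interpret F: hilbert_module F by fact
  have xy': "t x = Some \<zero>\<^bsub>F\<^esub>" "t y = Some \<zero>\<^bsub>F\<^esub>" using xy by (auto simp: ker_def)
  then have d: "x \<in> dom t" "y \<in> dom t" by auto
  have D: "submodule E (dom t)" and L: "linear_map_on E F (dom t) (\<lambda>x. the (t x))"
    using t by (auto simp: semi_regular_def hoperator_def)
  have "x \<oplus>\<^bsub>E\<^esub> y \<in> dom t" using D d unfolding submodule_def by blast
  moreover have "the (t (x \<oplus>\<^bsub>E\<^esub> y)) = \<zero>\<^bsub>F\<^esub>"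
    using L d xy' unfolding linear_map_on_def by simp
  ultimately show ?thesis by (auto simp: ker_def)
qed

theorem theorem1p7:
  fixes E :: "int \<Rightarrow> ('a::cstar_algebra, 'e) hmodule"
    and t :: "int \<Rightarrow> ('e \<rightharpoonup> 'e)"
    and k :: int
  assumes "hilbert_complex E t"
    and "strong_hodge_decomposition E t"
  shows "closedin (htop (kernel_module E t k)) (ran (t (k - 1))) \<and>
    orth_complemented (kernel_module E t k) (ran (t (k - 1))) \<and>
    cohomology_module E t k \<cong>\<^sub>H harmonic_module E t k"
proof -
  interpret hilbert_complex E t by fact
  interpret M: hilbert_module "E k" by (rule module)
  define K where "K = ker (E (k + 1)) (t k)"
  define H where "H = harmonic_space E t k"
  define A where "A = ran (adj (E k) (E (k + 1)) (t k))"
  define B where "B = ran (t (k - 1))"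
  have t: "semi_regular (E k) (E (k + 1)) (t k)"
    and s: "semi_regular (E (k - 1)) (E k) (t (k - 1))"
    using regular[of k] regular[of "k - 1"] by (auto simp: regular_ops_def)
  have carr: "carrier (E k) = H <+>\<^bsub>E k\<^esub> A <+>\<^bsub>E k\<^esub> B"
    and orth: "orthogonal_sets (E k) H A" "orthogonal_sets (E k) H B" "orthogonal_sets (E k) A B"
    using assms(2) unfolding strong_hodge_decomposition_def Let_def H_def A_def B_def by blast+
  have Kc: "K \<subseteq> carrier (E k)" using t by (auto simp: K_def ker_def semi_regular_def dense_in_def)
  have HK: "H \<subseteq> K" by (simp add: H_def K_def harmonic_space_def)
  have BK: "B \<subseteq> K" using ran_subset_ker[of "k - 1"] by (simp add: B_def K_def add.commute)
  have Ac: "A \<subseteq> carrier (E k)"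
    using adj_SomeD[OF module t] by (auto simp: A_def ran_def adjoint_pair_def)
  have Hc: "H \<subseteq> carrier (E k)" and Bc: "B \<subseteq> carrier (E k)" using HK BK Kc by auto
  have BH: "\<langle>b, h\<rangle>\<^bsub>E k\<^esub> = 0" if "b \<in> B" "h \<in> H" for b h
    using that orth(2) M.ip_eq_0_sym[of h b] Hc Bc by (auto simp: orthogonal_sets_def subset_iff)
  have KA: "\<langle>x, a\<rangle>\<^bsub>E k\<^esub> = 0" if "x \<in> K" "a \<in> A" for x a
    using ker_orthogonal_ran_adj[OF module module t] that by (simp add: K_def A_def)
  have HB_K: "H <+>\<^bsub>E k\<^esub> B \<subseteq> K"
    using HK BK ker_add_closed[OF module t] unfolding set_add_def' K_def by blast
  have "carrier (E k) = (H <+>\<^bsub>E k\<^esub> B) <+>\<^bsub>E k\<^esub> A"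
    unfolding carr using Hc Ac Bc
    by (rule M.set_add_right_commute)
  then have K_HB: "orth_compl (E k) A = H <+>\<^bsub>E k\<^esub> B"
    using HB_K Kc Ac KA by (intro M.orth_compl_of_orthogonal_summand) auto
  then have K_sum: "K = H <+>\<^bsub>E k\<^esub> B" and K_orth: "K = orth_compl (E k) A"
    using HB_K Kc KA by (auto simp: orth_compl_def)
  \<comment> \<open>From here on everything takes place in the Hilbert module \<open>K = B + H\<close>.\<close>
  let ?K = "kernel_module E t k"
  have K_def': "?K = E k\<lparr>carrier := K\<rparr>" by (simp add: kernel_module_def K_def)
  interpret K: hilbert_module ?K
    unfolding K_def' K_orth
    by (intro M.closed_submodule_hilbert_module M.submodule_orth_compl M.closedin_orth_compl Ac)
  have sums: "carrier ?K = B <+>\<^bsub>?K\<^esub> H" "carrier ?K = H <+>\<^bsub>?K\<^esub> B"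
    using M.set_add_commute[OF Hc Bc] by (simp_all add: K_def' K_sum set_add_def')
  have orth_B: "orth_compl ?K B = H"
    using sums(2) HK BK orth(2)
    by (intro K.orth_compl_of_orthogonal_summand) (auto simp: K_def' orthogonal_sets_def)
  have orth_H: "orth_compl ?K H = B"
    using sums(1) HK BK BH
    by (intro K.orth_compl_of_orthogonal_summand) (auto simp: K_def')
  have H_sub: "H \<subseteq> carrier ?K" using HK by (simp add: K_def')
  have closed: "closedin (htop ?K) B" and "submodule ?K B"
    using K.closedin_orth_compl[OF H_sub] K.submodule_orth_compl[OF H_sub] by (simp_all add: orth_H)
  then have compl: "orth_complemented ?K B"
    using sums(1) by (simp add: orth_complemented_def orth_B)
  have "cohomology_module E t k \<cong>\<^sub>H ?K\<lparr>carrier := orth_compl ?K B\<rparr>"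
    unfolding cohomology_module_def B_def[symmetric] by (rule K.quotient_hmodule_iso_orth_compl[OF compl])
  also have "?K\<lparr>carrier := orth_compl ?K B\<rparr> = harmonic_module E t k"
    unfolding orth_B by (simp add: K_def' harmonic_module_def H_def)
  finally show ?thesis using closed compl by (simp add: B_def)
qed

end
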